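(* Let $\eta\in(0,1/2]$ and let $\{y_g\}_{g \in \{ \pm 1\}^n}$ be an $(m,n,\tfrac 12 - \eta)$ classical random access code or pure quantum random access code. Then \[ m \geq \log n - \log \log \frac 1 {\eta^2} - O(1). \] And if $\eta \geq 10/\sqrt{n}$, \[ m \geq \log \frac 1 {\eta^2} + \Omega(\eta^2 n). \] Furthermore, the same inequalities hold if the code is only $(\delta,t)$-weak (for some subset $\mathcal S$), provided $\delta \leq \delta_0$ and $t \leq t_0 n$ for suitable universal constants $\delta_0,t_0>0$. (All implicit constants are universal.)
   Context: Logarithms are base 2. An $(m,n,\epsilon)$ classical random access code is a map from messages $g \in \{ \pm 1\}^n$ to probability distributions over $m$-bit codewords $y_g$, together with decoding procedures $D_1,\ldots,D_n : \{\pm1\}^m \to \{\pm 1\}$ (possibly randomized), such that for all $g$ and all $i$, $D_i$ run on $y_g$ outputs $g_i$ with probability at least $1-\epsilon$. An $(m,n,\epsilon)$ pure quantum random access code assigns to each $g$ an $m$-qubit pure state $y_g$ (a unit vector in $\mathbb{R}^{2^m}$), together with quantum decoding procedures $D_1,\ldots,D_n$ (two-outcome measurements with outcomes in $\{\pm1\}$) such that for all $g$ and $i$, $D_i$ applied to $y_g$ outputs $g_i$ with probability at least $1-\epsilon$. Such a code is $(\delta,t)$-weak for a subset $\mathcal S \subseteq \{\pm1\}^n$ if it contains messages $y_g$ only for $g \in \mathcal S$, where $\log |\mathcal S| \geq n-t$, and if for each $g\in\mathcal S$ at least a $(1-\delta)$ fraction of the indices $i\in[n]$ have $D_i$ output $g_i$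 on $y_g$ with probability at least $1-\epsilon$. *)

theory Defs
  imports
    "HOL-Probability.Probability_Mass_Function"
    "Jordan_Normal_Form.Schur_Decomposition"
begin

text \<open>Elements of \<open>{\<plusminus>1}\<^sup>n\<close> are extensional functions on the index set \<open>{0, \<dots>, n - 1}\<close>.\<close>

definition sign_cube :: "nat \<Rightarrow> (nat \<Rightarrow> int) set" where
  "sign_cube n = {..<n} \<rightarrow>\<^sub>E {-1, 1}"


subsection \<open>Classical random access codes\<close>

text \<open>The codeword of the message \<open>g\<close> is the distribution \<open>y g\<close>; the \<open>i\<close>-th randomized decoder
  maps each \<open>m\<close>-bit string to a distribution on \<open>{\<plusminus>1}\<close>.\<close>

definition classical_encoder ::
  "nat \<Rightarrow> (nat \<Rightarrow> int) set \<Rightarrow> ((nat \<Rightarrow> int) \<Rightarrow> (nat \<Rightarrow> int) pmf) \<Rightarrow> bool" where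
  "classical_encoder m S y \<longleftrightarrow> (\<forall>g\<in>S. set_pmf (y g) \<subseteq> sign_cube m)"

definition classical_decoders ::
  "nat \<Rightarrow> nat \<Rightarrow> (nat \<Rightarrow> (nat \<Rightarrow> int) \<Rightarrow> int pmf) \<Rightarrow> bool" where
  "classical_decoders m n D \<longleftrightarrow> (\<forall>i<n. \<forall>w\<in>sign_cube m. set_pmf (D i w) \<subseteq> {-1, 1})"

definition classical_prob :: "(nat \<Rightarrow> int) pmf \<Rightarrow> ((nat \<Rightarrow> int) \<Rightarrow> int pmf) \<Rightarrow> int \<Rightarrow> real" where
  "classical_prob \<mu> Di s = pmf (bind_pmf \<mu> Di) s"

definition classical_rac ::
  "nat \<Rightarrow> nat \<Rightarrow> real \<Rightarrow> ((nat \<Rightarrow> int) \<Rightarrow> (nat \<Rightarrow> int) pmf)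
    \<Rightarrow> (nat \<Rightarrow> (nat \<Rightarrow> int) \<Rightarrow> int pmf) \<Rightarrow> bool" where
  "classical_rac m n \<epsilon> y D \<longleftrightarrow>
     classical_encoder m (sign_cube n) y \<and> classical_decoders m n D \<and>
     (\<forall>g\<in>sign_cube n. \<forall>i<n. classical_prob (y g) (D i) (g i) \<ge> 1 - \<epsilon>)"


subsection \<open>Pure quantum random access codes\<close>

text \<open>Codewords are real unit vectors, as amplitudes of \<open>m\<close>-qubit pure states. The decoders are
  arbitrary two-outcome POVMs with complex effects \<open>E 1\<close> and \<open>E (-1)\<close>; this includes all real
  symmetric ones.\<close>

definition quantum_encoder ::
  "nat \<Rightarrow> (nat \<Rightarrow> int) set \<Rightarrow> ((nat \<Rightarrow> int) \<Rightarrow> real Matrix.vec) \<Rightarrow> bool" where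
  "quantum_encoder m S y \<longleftrightarrow>
     (\<forall>g\<in>S. y g \<in> carrier_vec (2 ^ m) \<and> scalar_prod (y g) (y g) = 1)"

definition psd_mat :: "nat \<Rightarrow> complex Matrix.mat \<Rightarrow> bool" where
  "psd_mat d A \<longleftrightarrow> A \<in> carrier_mat d d \<and> mat_adjoint A = A \<and>
     (\<forall>v\<in>carrier_vec d. Re (cscalar_prod (A *\<^sub>v v) v) \<ge> 0)"

definition two_outcome_povm :: "nat \<Rightarrow> (int \<Rightarrow> complex Matrix.mat) \<Rightarrow> bool" where
  "two_outcome_povm d E \<longleftrightarrow> psd_mat d (E 1) \<and> psd_mat d (E (-1)) \<and> E 1 + E (-1) = 1\<^sub>m d"

definition quantum_decoders :: "nat \<Rightarrow> nat \<Rightarrow> (nat \<Rightarrow> int \<Rightarrow> complex Matrix.mat) \<Rightarrow> bool" where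
  "quantum_decoders m n E \<longleftrightarrow> (\<forall>i<n. two_outcome_povm (2 ^ m) (E i))"

text \<open>Born rule; the scalar product conjugates its second argument, and its value is real for
  Hermitian effects.\<close>

definition quantum_prob :: "real Matrix.vec \<Rightarrow> (int \<Rightarrow> complex Matrix.mat) \<Rightarrow> int \<Rightarrow> real" where
  "quantum_prob \<psi> Ei s =
     (let v = map_vec complex_of_real \<psi> in Re (cscalar_prod (Ei s *\<^sub>v v) v))"

definition pure_quantum_rac ::
  "nat \<Rightarrow> nat \<Rightarrow> real \<Rightarrow> ((nat \<Rightarrow> int) \<Rightarrow> real Matrix.vec)
    \<Rightarrow> (nat \<Rightarrow> int \<Rightarrow> complex Matrix.mat) \<Rightarrow> bool" where
  "pure_quantum_rac m n \<epsilon> y E \<longleftrightarrow>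
     quantum_encoder m (sign_cube n) y \<and> quantum_decoders m n E \<and>
     (\<forall>g\<in>sign_cube n. \<forall>i<n. quantum_prob (y g) (E i) (g i) \<ge> 1 - \<epsilon>)"


subsection \<open>Weak codes\<close>

text \<open>Nonemptiness is explicit since \<open>log 2 0 = 0\<close>, whereas \<open>log |{}| = -\<infinity>\<close> is intended.\<close>

definition large_message_set :: "nat \<Rightarrow> real \<Rightarrow> (nat \<Rightarrow> int) set \<Rightarrow> bool" where
  "large_message_set n t S \<longleftrightarrow>
     S \<subseteq> sign_cube n \<and> S \<noteq> {} \<and> log 2 (real (card S)) \<ge> real n - t"

definition weak_classical_rac ::
  "nat \<Rightarrow> nat \<Rightarrow> real \<Rightarrow> real \<Rightarrow> real \<Rightarrow> (nat \<Rightarrow> int) set \<Rightarrow> ((nat \<Rightarrow> int) \<Rightarrow> (nat \<Rightarrow> int) pmf)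
    \<Rightarrow> (nat \<Rightarrow> (nat \<Rightarrow> int) \<Rightarrow> int pmf) \<Rightarrow> bool" where
  "weak_classical_rac m n \<epsilon> \<delta> t S y D \<longleftrightarrow>
     large_message_set n t S \<and> classical_encoder m S y \<and> classical_decoders m n D \<and>
     (\<forall>g\<in>S. real (card {i. i < n \<and> classical_prob (y g) (D i) (g i) \<ge> 1 - \<epsilon>})
              \<ge> (1 - \<delta>) * real n)"

definition weak_pure_quantum_rac ::
  "nat \<Rightarrow> nat \<Rightarrow> real \<Rightarrow> real \<Rightarrow> real \<Rightarrow> (nat \<Rightarrow> int) set \<Rightarrow> ((nat \<Rightarrow> int) \<Rightarrow> real Matrix.vec)
    \<Rightarrow> (nat \<Rightarrow> int \<Rightarrow> complex Matrix.mat) \<Rightarrow> bool" where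
  "weak_pure_quantum_rac m n \<epsilon> \<delta> t S y E \<longleftrightarrow>
     large_message_set n t S \<and> quantum_encoder m S y \<and> quantum_decoders m n E \<and>
     (\<forall>g\<in>S. real (card {i. i < n \<and> quantum_prob (y g) (E i) (g i) \<ge> 1 - \<epsilon>})
              \<ge> (1 - \<delta>) * real n)"

end

(*
  A classical code becomes a pure quantum one by taking square roots of the codeword probabilities,
  and every decoder can be refined to a rank one measurement, that is, a tight frame.
  Give the decoder k = ceiling(1 / eta^2) copies of the codeword: by Chebyshev a majority vote then
  has constant bias. As the codewords are pure, the k copies live in the symmetric power, whose
  dimension D is the number of types of words of length k over 2^m letters. A code of constant bias
  needs D >= 2^(n / 25): for a power of two p of order n, the trace of the 2p-th power of the signed sum
  of the compressed observables is at most D (p n)^p on average over the signs, but at least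
  (9 n / 20)^(2p) whenever the signs form a message of the code.
  Finally D <= (k + 1)^(2^m) gives the first inequality and D <= (e (2^m + k) / k)^k the second.
*)
theory Submission
  imports Defs
begin

text \<open>Weak codes force the amplification to come before the moment method. On the codewords
  themselves a bias of order \<open>\<eta>\<close> could not outweigh a constant fraction of indices
  that fail to decode, and the gain of the moment method, a factor of about 2^(c eta^2 n), could not
  outweigh the factor 2^t by which \<open>S\<close> may be smaller than the cube. With constant bias
  the gain is 2^(c n), which leaves room for universal \<open>\<delta>\<^sub>0\<close> and
  \<open>t\<^sub>0\<close>. The symmetric power is what produces the logarithms: the full tensor
  power has dimension 2^(m k), and comparing this with 2^(n / 25) would give only m >= n / (25 k),
  of order eta^2 n. A product distribution, seen as a mixed state, is not confined to symmetric
  tensors; the k-th power of the amplitude vector is, and a decoder that reads the codeword in the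
  standard basis cannot tell the two apart. The effects of a quantum decoder are complex, but
  codewords are real, so only real parts of effects enter the probabilities and all the linear
  algebra is real.\<close>

subsection \<open>Positive semidefinite kernels and tight frames\<close>

text \<open>Serves to show that a zero diagonal entry of a positive semidefinite kernel forces a
  zero row: \<open>b\<close> is the entry off the diagonal, \<open>c\<close> the other diagonal
  entry. As \<open>d > c\<close> whatever the sign of \<open>c\<close>, the point
  \<open>s = - b / d\<close> makes the form negative unless \<open>b = 0\<close>.\<close>

lemma nonneg_quadratic_imp_zero:
  fixes b c :: real
  assumes "\<And>s. 0 \<le> 2 * s * b + s\<^sup>2 * c"
  shows "b = 0"
proof (rule ccontr)
  assume "b \<noteq> 0"
  define d where "d = \<bar>c\<bar> + 1"
  have d: "d > 0" "c \<le> d - 1" by (auto simp: d_def)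
  have "0 \<le> 2 * (- b / d) * b + (- b / d)\<^sup>2 * c" by (rule assms)
  also have "\<dots> = (b\<^sup>2 / d) * (c / d - 2)"
    using d by (simp add: power2_eq_square field_simps)
  finally have "0 \<le> (b\<^sup>2 / d) * (c / d - 2)" .
  moreover have "b\<^sup>2 / d > 0" using \<open>b \<noteq> 0\<close> d by simp
  moreover have "c / d < 2" using d by (simp add: field_simps)
  ultimately show False
    by (smt (verit) mult_pos_neg)
qed

text \<open>Cholesky factorisation by induction on the index set. The rows are indexed by
  \<open>A\<close> itself, so an effect on \<open>X\<close> splits into rank one pieces indexed by
  \<open>X\<close>; hence the outcome sets \<open>X \<times> {-1, 1}\<close> later on.\<close>

lemma psd_kernel_gram:
  fixes E :: "'a \<Rightarrow> 'a \<Rightarrow> real"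
  assumes "finite A"
    and "\<And>a b. a \<in> A \<Longrightarrow> b \<in> A \<Longrightarrow> E a b = E b a"
    and "\<And>v. 0 \<le> (\<Sum>a\<in>A. \<Sum>b\<in>A. v a * E a b * v b)"
  shows "\<exists>B. \<forall>a\<in>A. \<forall>b\<in>A. E a b = (\<Sum>r\<in>A. B r a * B r b)"
  using assms
proof (induction A arbitrary: E rule: finite_induct)
  case empty
  then show ?case by simp
next
  case (insert x A)
  note sym = insert.prems(1) and psd = insert.prems(2)
  have expand: "(\<Sum>a\<in>insert x A. \<Sum>b\<in>insert x A. v a * E a b * v b) =
      (v x)\<^sup>2 * E x x + 2 * v x * (\<Sum>b\<in>A. E x b * v b) + (\<Sum>a\<in>A. \<Sum>b\<in>A. v a * E a b * v b)" for v
  proof -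
    have 1: "(\<Sum>a\<in>A. v a * E a x * v x) = v x * (\<Sum>b\<in>A. E x b * v b)"
      by (subst sum_distrib_left, rule sum.cong) (use sym in auto)
    have 2: "(\<Sum>b\<in>A. v x * E x b * v b) = v x * (\<Sum>b\<in>A. E x b * v b)"
      by (simp add: sum_distrib_left mult.assoc)
    have "(\<Sum>a\<in>insert x A. \<Sum>b\<in>insert x A. v a * E a b * v b) =
        v x * E x x * v x + (\<Sum>b\<in>A. v x * E x b * v b) +
        ((\<Sum>a\<in>A. v a * E a x * v x) + (\<Sum>a\<in>A. \<Sum>b\<in>A. v a * E a b * v b))"
      using insert.hyps by (simp add: sum.distrib)
    then show ?thesis
      unfolding 1 2 by (simp add: power2_eq_square)
  qed
  have Exx: "0 \<le> E x x"
  proof -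
    have "(\<Sum>b\<in>A. E x b * (if b = x then 1 else 0)) = 0"
      by (rule sum.neutral) (use insert.hyps in auto)
    moreover have "(\<Sum>a\<in>A. \<Sum>b\<in>A. (if a = x then 1 else 0) * E a b * (if b = x then 1 else 0)) = 0"
      by (rule sum.neutral) (use insert.hyps in auto)
    ultimately show ?thesis
      using psd[of "\<lambda>a. if a = x then 1 else 0"] unfolding expand by simp
  qed
  have row: "E x a = 0" if "a \<in> A" "E x x = 0" for a
  proof (rule nonneg_quadratic_imp_zero[where c = "E a a"])
    fix s :: real
    define v where "v = (\<lambda>b. if b = x then 1 else if b = a then s else 0)"
    have [simp]: "v x = 1" by (simp add: v_def)
    have on_A: "v b = (if b = a then s else 0)" if "b \<in> A" for b
      using that insert.hyps by (auto simp: v_def)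
    have 1: "(\<Sum>b\<in>A. E x b * v b) = s * E x a"
      using \<open>a \<in> A\<close> insert.hyps by (simp add: on_A if_distrib sum.delta cong: if_cong sum.cong)
    have "(\<Sum>c\<in>A. \<Sum>b\<in>A. v c * E c b * v b) =
        (\<Sum>c\<in>A. if c = a then (\<Sum>b\<in>A. if b = a then s * E a a * s else 0) else 0)"
      by (rule sum.cong) (auto simp: on_A intro!: sum.cong sum.neutral)
    also have "\<dots> = s\<^sup>2 * E a a"
      using \<open>a \<in> A\<close> insert.hyps by (simp add: sum.delta power2_eq_square)
    finally show "0 \<le> 2 * s * E x a + s\<^sup>2 * E a a"
      using psd[of v] that(2) unfolding expand by (simp add: 1)
  qed
  \<comment> \<open>Schur complement of the entry at \<open>x\<close>; if that entry vanishes, so does its row, and the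
    convention \<open>z / 0 = 0\<close> makes the same formulas work.\<close>
  define E' where "E' = (\<lambda>a b. E a b - E x a * E x b / E x x)"
  have "\<exists>B. \<forall>a\<in>A. \<forall>b\<in>A. E' a b = (\<Sum>r\<in>A. B r a * B r b)"
  proof (rule insert.IH)
    show "E' a b = E' b a" if "a \<in> A" "b \<in> A" for a b
      using sym[of a b] that by (simp add: E'_def)
    show "0 \<le> (\<Sum>a\<in>A. \<Sum>b\<in>A. v a * E' a b * v b)" for v
    proof -
      define l where "l = (\<Sum>b\<in>A. E x b * v b)"
      \<comment> \<open>For \<open>E x x > 0\<close> this value at \<open>x\<close> minimises the
        full form with the other coordinates fixed, and the Schur complement takes exactly that
        minimum as its value at \<open>v\<close>.\<close>
      define w where "w = (\<lambda>b. if b = x then - l / E x x else v b)"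
      have [simp]: "w x = - l / E x x" by (simp add: w_def)
      have on_A: "w b = v b" if "b \<in> A" for b
        using that insert.hyps by (auto simp: w_def)
      have "l * l = (\<Sum>a\<in>A. \<Sum>b\<in>A. (E x a * v a) * (E x b * v b))"
        unfolding l_def by (rule sum_product)
      then have "(\<Sum>a\<in>A. \<Sum>b\<in>A. v a * E' a b * v b)
          = (\<Sum>a\<in>A. \<Sum>b\<in>A. v a * E a b * v b) - l * l / E x x"
        by (simp add: E'_def left_diff_distrib right_diff_distrib sum_subtractf
            sum_divide_distrib mult_ac)
      also have "\<dots> = (\<Sum>a\<in>insert x A. \<Sum>b\<in>insert x A. w a * E a b * w b)"
        unfolding expand using Exx
        by (cases "E x x = 0") (simp_all add: on_A l_def[symmetric] power2_eq_square cong: sum.cong)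
      also have "\<dots> \<ge> 0" by (rule psd)
      finally show ?thesis .
    qed
  qed
  then obtain B where B: "\<And>a b. a \<in> A \<Longrightarrow> b \<in> A \<Longrightarrow> E' a b = (\<Sum>r\<in>A. B r a * B r b)"
    by blast
  define B' where "B' = (\<lambda>r a. if r = x then E x a / sqrt (E x x) else if a = x then 0 else B r a)"
  have "E a b = (\<Sum>r\<in>insert x A. B' r a * B' r b)" if ab: "a \<in> insert x A" "b \<in> insert x A" for a b
  proof -
    have "(\<Sum>r\<in>insert x A. B' r a * B' r b) = E x a * E x b / E x x + (\<Sum>r\<in>A. B' r a * B' r b)"
      using insert.hyps Exx by (simp add: B'_def)
    also have "(\<Sum>r\<in>A. B' r a * B' r b) = (\<Sum>r\<in>A. if a = x \<or> b = x then 0 else B r a * B r b)"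
      by (rule sum.cong) (use insert.hyps in \<open>auto simp: B'_def\<close>)
    also have "\<dots> = (if a = x \<or> b = x then 0 else E' a b)"
      using B[of a b] ab by auto
    also have "E x a * E x b / E x x + \<dots> = E a b"
      using row[of a] row[of b] sym[of a b] ab by (cases "E x x = 0") (auto simp: E'_def)
    finally show ?thesis ..
  qed
  then show ?case by blast
qed

text \<open>The vectors \<open>h r\<close> resolve the identity, so they describe a rank one
  measurement with outcomes in \<open>R\<close>: on a unit vector, outcome \<open>r\<close> has as
  probability the squared inner product with \<open>h r\<close>.\<close>

definition tight_frame :: "'a set \<Rightarrow> 'r set \<Rightarrow> ('r \<Rightarrow> 'a \<Rightarrow> real) \<Rightarrow> bool" where
  "tight_frame X R h \<longleftrightarrow>
     (\<forall>a\<in>X. \<forall>b\<in>X. (\<Sum>r\<in>R. h r a * h r b) = (if a = b then 1 else 0))"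

lemma tight_frame_parseval:
  assumes "finite X" "tight_frame X R h"
  shows "(\<Sum>r\<in>R. (\<Sum>a\<in>X. h r a * u a) * (\<Sum>a\<in>X. h r a * v a)) = (\<Sum>a\<in>X. u a * v a)"
proof -
  have "(\<Sum>r\<in>R. (\<Sum>a\<in>X. h r a * u a) * (\<Sum>a\<in>X. h r a * v a))
      = (\<Sum>r\<in>R. \<Sum>a\<in>X. \<Sum>b\<in>X. u a * v b * (h r a * h r b))"
    by (simp add: sum_product mult_ac)
  also have "\<dots> = (\<Sum>a\<in>X. \<Sum>r\<in>R. \<Sum>b\<in>X. u a * v b * (h r a * h r b))"
    by (rule sum.swap)
  also have "\<dots> = (\<Sum>a\<in>X. \<Sum>b\<in>X. \<Sum>r\<in>R. u a * v b * (h r a * h r b))"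
    by (intro sum.cong refl sum.swap)
  also have "\<dots> = (\<Sum>a\<in>X. \<Sum>b\<in>X. u a * v b * (if a = b then 1 else 0))"
    using assms(2) by (auto simp: tight_frame_def simp flip: sum_distrib_left intro!: sum.cong)
  also have "\<dots> = (\<Sum>a\<in>X. u a * v a)"
    using assms(1) by (simp add: if_distrib cong: if_cong)
  finally show ?thesis .
qed

subsection \<open>The trace moment method for sign sums of contractions\<close>

text \<open>The sum factorises over the coordinates into factors 0 or 2, according to the parity of
  \<open>e i\<close>. This positivity is what lets operator words be compared with scalar
  ones.\<close>

lemma sum_sign_monomial_nonneg:
  fixes e :: "nat \<Rightarrow> nat"
  shows "0 \<le> (\<Sum>g\<in>sign_cube n. \<Prod>i<n. real_of_int (g i) ^ e i)"
proof -
  have "(\<Sum>g\<in>sign_cube n. \<Prod>i<n. real_of_int (g i) ^ e i)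
      = (\<Prod>i<n. \<Sum>s\<in>{-1, 1}. real_of_int s ^ e i)"
    unfolding sign_cube_def by (subst prod_sum_PiE) auto
  also have "\<dots> \<ge> 0"
  proof (rule prod_nonneg)
    fix i
    show "0 \<le> (\<Sum>s\<in>{-1, 1}. real_of_int s ^ e i)"
      by (cases "even (e i)") auto
  qed
  finally show ?thesis .
qed

lemma finite_sign_cube [simp]: "finite (sign_cube n)"
  by (auto simp: sign_cube_def intro!: finite_PiE)

lemma card_sign_cube: "card (sign_cube n) = 2 ^ n"
  by (simp add: sign_cube_def card_PiE numeral_2_eq_2)

text \<open>The quotient \<open>fact (2 * p) / (2 ^ p * fact p)\<close> is the double factorial (2p
  - 1)!!. The two sides differ exactly by the factor (2j - 1)!!, which is at least 1.\<close>

lemma choose_double_factorial_le: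
  assumes "j \<le> p"
  shows "real (2 * p choose (2 * j)) * (fact (2 * (p - j)) / (2 ^ (p - j) * fact (p - j)))
    \<le> real (p choose j) * (fact (2 * p) / (2 ^ p * fact p))"
proof -
  have two: "(2::real) ^ j * fact j \<le> fact (2 * j)"
  proof (induction j)
    case (Suc j)
    have "(2::real) ^ Suc j * fact (Suc j) = (2 * real (Suc j)) * (2 ^ j * fact j)"
      by simp
    also have "\<dots> \<le> (2 * real (Suc j)) * fact (2 * j)"
      by (intro mult_left_mono Suc.IH) simp
    also have "\<dots> \<le> (2 * real (Suc j)) * (real (2 * j + 1) * fact (2 * j))"
      by (intro mult_left_mono) simp_all
    also have "\<dots> = fact (2 * Suc j)" by (simp add: algebra_simps)
    finally show ?case .
  qed simp
  have p: "(2::real) ^ p = 2 ^ j * 2 ^ (p - j)"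
    using assms by (simp flip: power_add)
  have d: "2 * p - 2 * j = 2 * (p - j)" by simp
  have "real (2 * p choose (2 * j)) * (fact (2 * (p - j)) / (2 ^ (p - j) * fact (p - j)))
     = fact (2 * p) / (2 ^ (p - j) * fact (p - j)) / fact (2 * j)"
    using assms by (simp add: binomial_fact d)
  also have "\<dots> \<le> fact (2 * p) / (2 ^ (p - j) * fact (p - j)) / (2 ^ j * fact j)"
    by (intro divide_left_mono two) auto
  also have "\<dots> = real (p choose j) * (fact (2 * p) / (2 ^ p * fact p))"
    using assms by (simp add: binomial_fact p field_simps)
  finally show ?thesis .
qed

lemma sum_even_terms:
  fixes f :: "nat \<Rightarrow> real"
  assumes "\<And>j. odd j \<Longrightarrow> f j = 0"
  shows "(\<Sum>j\<le>2 * p. f j) = (\<Sum>j\<le>p. f (2 * j))"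
  by (induction p) (use assms in auto)

lemma sum_sign_cube_Suc:
  fixes F :: "int \<Rightarrow> real"
  shows "(\<Sum>g\<in>sign_cube (Suc n). F (\<Sum>i<Suc n. g i)) =
    (\<Sum>g\<in>sign_cube n. F ((\<Sum>i<n. g i) + 1) + F ((\<Sum>i<n. g i) - 1))"
proof -
  have *: "(\<Sum>i<n. (g(n := s)) i) = (\<Sum>i<n. g i)" for g :: "nat \<Rightarrow> int" and s
    by (rule sum.cong) auto
  have "sign_cube (Suc n) = (\<lambda>(s, g). g(n := s)) ` ({-1, 1} \<times> sign_cube n)"
    unfolding sign_cube_def lessThan_Suc by (rule PiE_insert_eq)
  moreover have "inj_on (\<lambda>(s, g). g(n := s)) ({-1, 1} \<times> sign_cube n)"
    unfolding sign_cube_def by (rule inj_combinator) simp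
  ultimately have "(\<Sum>g\<in>sign_cube (Suc n). F (\<Sum>i<Suc n. g i)) =
      (\<Sum>(s, g)\<in>{-1, 1} \<times> sign_cube n. F ((\<Sum>i<n. g i) + s))"
    by (simp add: sum.reindex case_prod_unfold * lessThan_Suc add.commute)
  also have "\<dots> = (\<Sum>s\<in>{-1, 1}. \<Sum>g\<in>sign_cube n. F ((\<Sum>i<n. g i) + s))"
    by (rule sum.cartesian_product[symmetric])
  also have "\<dots> = (\<Sum>g\<in>sign_cube n. F ((\<Sum>i<n. g i) + 1) + F ((\<Sum>i<n. g i) - 1))"
    by (simp add: sum.distrib)
  finally show ?thesis .
qed

text \<open>The factor (2p - 1)!! is the Gaussian moment. It suits the induction on
  \<open>n\<close>: after adding one more sign the even binomial terms are dominated one by one, and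
  they add up to (n + 1)^p by the binomial theorem.\<close>

lemma rademacher_even_moment:
  "(\<Sum>g\<in>sign_cube n. real_of_int (\<Sum>i<n. g i) ^ (2 * p))
    \<le> 2 ^ n * (fact (2 * p) / (2 ^ p * fact p)) * real n ^ p"
proof (induction n arbitrary: p)
  case 0
  show ?case by (cases p) (simp_all add: sign_cube_def)
next
  case (Suc n)
  let ?X = "\<lambda>g::nat\<Rightarrow>int. real_of_int (\<Sum>i<n. g i)"
  have pm: "(x + 1) ^ (2 * p) + (x - 1) ^ (2 * p) =
      2 * (\<Sum>j\<le>p. real (2 * p choose (2 * j)) * x ^ (2 * (p - j)))" for x :: real
  proof -
    have "(x + 1) ^ (2 * p) + (x - 1) ^ (2 * p) =
        (\<Sum>j\<le>2 * p. (1 + (-1) ^ j) * (real (2 * p choose j) * x ^ (2 * p - j)))"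
      using binomial_ring[of 1 x "2 * p"] binomial_ring[of "-1" x "2 * p"]
      by (simp add: sum.distrib algebra_simps)
    also have "\<dots> = (\<Sum>j\<le>p. (1 + (-1) ^ (2 * j)) * (real (2 * p choose (2 * j)) * x ^ (2 * p - 2 * j)))"
      by (rule sum_even_terms) simp
    also have "\<dots> = 2 * (\<Sum>j\<le>p. real (2 * p choose (2 * j)) * x ^ (2 * (p - j)))"
      by (simp add: sum_distrib_left right_diff_distrib')
    finally show ?thesis .
  qed
  have "(\<Sum>g\<in>sign_cube (Suc n). real_of_int (\<Sum>i<Suc n. g i) ^ (2 * p)) =
      (\<Sum>g\<in>sign_cube n. (?X g + 1) ^ (2 * p) + (?X g - 1) ^ (2 * p))"
    using sum_sign_cube_Suc[of "\<lambda>x. real_of_int x ^ (2 * p)" n] by simp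
  also have "\<dots> = 2 * (\<Sum>g\<in>sign_cube n. \<Sum>j\<le>p. real (2 * p choose (2 * j)) * ?X g ^ (2 * (p - j)))"
    unfolding pm by (simp only: sum_distrib_left)
  also have "\<dots> = 2 * (\<Sum>j\<le>p. real (2 * p choose (2 * j)) * (\<Sum>g\<in>sign_cube n. ?X g ^ (2 * (p - j))))"
    by (subst sum.swap) (simp only: sum_distrib_left)
  also have "\<dots> \<le> 2 * (\<Sum>j\<le>p. real (2 * p choose (2 * j)) *
      (2 ^ n * (fact (2 * (p - j)) / (2 ^ (p - j) * fact (p - j))) * real n ^ (p - j)))"
    by (intro mult_left_mono sum_mono Suc.IH) auto
  also have "\<dots> = 2 ^ Suc n * (\<Sum>j\<le>p. (real (2 * p choose (2 * j)) *
      (fact (2 * (p - j)) / (2 ^ (p - j) * fact (p - j)))) * real n ^ (p - j))"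
    by (simp add: sum_distrib_left mult_ac)
  also have "\<dots> \<le> 2 ^ Suc n * (\<Sum>j\<le>p. (real (p choose j) *
      (fact (2 * p) / (2 ^ p * fact p))) * real n ^ (p - j))"
    by (intro mult_left_mono sum_mono mult_right_mono choose_double_factorial_le) auto
  also have "\<dots> = 2 ^ Suc n * (fact (2 * p) / (2 ^ p * fact p)) *
      (\<Sum>j\<le>p. real (p choose j) * 1 ^ j * real n ^ (p - j))"
    by (simp add: sum_distrib_left sum_divide_distrib mult_ac)
  also have "(\<Sum>j\<le>p. real (p choose j) * 1 ^ j * real n ^ (p - j)) = real (Suc n) ^ p"
    using binomial_ring[of 1 "real n" p] by (simp add: add.commute)
  finally show ?case .
qed

lemma fact_double_le: "fact (2 * p) / fact p \<le> (2 * real p) ^ p"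
proof -
  have "(fact (2 * p) :: real) / fact p = real (fact (2 * p) div fact p)"
    by (simp add: real_of_nat_div fact_dvd)
  also have "\<dots> \<le> real ((2 * p) ^ p)"
    using fact_div_fact_le_pow[of p "2 * p"] by (simp only: of_nat_le_iff mult_2 add_diff_cancel_right')
  also have "\<dots> = (2 * real p) ^ p" by simp
  finally show ?thesis .
qed

corollary rademacher_even_moment_le:
  "(\<Sum>g\<in>sign_cube n. real_of_int (\<Sum>i<n. g i) ^ (2 * p)) \<le> 2 ^ n * (real p * real n) ^ p"
proof -
  have "fact (2 * p) / (2 ^ p * fact p) = (fact (2 * p) / fact p) / (2::real) ^ p"
    by (simp add: field_simps)
  also have "\<dots> \<le> (2 * real p) ^ p / 2 ^ p"
    by (intro divide_right_mono fact_double_le) simp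
  also have "\<dots> = real p ^ p" by (simp add: power_mult_distrib)
  finally have "2 ^ n * (fact (2 * p) / (2 ^ p * fact p)) * real n ^ p \<le> 2 ^ n * real p ^ p * real n ^ p"
    by (intro mult_right_mono mult_left_mono) simp_all
  with rademacher_even_moment[of n p] show ?thesis
    by (simp add: power_mult_distrib mult.assoc)
qed

text \<open>Since the symmetric operators \<open>T i\<close> below are contractions, every word in them contributes at
  most \<open>card C\<close> to the trace of a power of \<open>\<Sum>\<^sub>i g i T i\<close>, whereas its coefficient has a nonnegative
  average over the sign vectors \<open>g\<close>. So on average that trace is at most \<open>card C\<close> times the scalar moment
  of \<open>\<Sum>\<^sub>i g i\<close>.\<close>

locale symmetric_contractions =
  fixes C :: "'c set" and n :: nat and M :: "nat \<Rightarrow> 'c \<Rightarrow> 'c \<Rightarrow> real"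
  assumes finite_C: "finite C"
    and M_sym: "\<And>i c d. i < n \<Longrightarrow> c \<in> C \<Longrightarrow> d \<in> C \<Longrightarrow> M i c d = M i d c"
    and M_contraction: "\<And>i u. i < n \<Longrightarrow>
      (\<Sum>c\<in>C. (\<Sum>d\<in>C. M i c d * u d)\<^sup>2) \<le> (\<Sum>c\<in>C. (u c)\<^sup>2)"
begin

definition T :: "nat \<Rightarrow> ('c \<Rightarrow> real) \<Rightarrow> 'c \<Rightarrow> real" where
  "T i u = (\<lambda>c. \<Sum>d\<in>C. M i c d * u d)"

definition G :: "(nat \<Rightarrow> int) \<Rightarrow> ('c \<Rightarrow> real) \<Rightarrow> 'c \<Rightarrow> real" where
  "G g u = (\<lambda>c. \<Sum>i<n. real_of_int (g i) * T i u c)"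

definition ip :: "('c \<Rightarrow> real) \<Rightarrow> ('c \<Rightarrow> real) \<Rightarrow> real" where
  "ip u v = (\<Sum>c\<in>C. u c * v c)"

definition unit :: "'c \<Rightarrow> 'c \<Rightarrow> real" where
  "unit c d = (if d = c then 1 else 0)"

lemma ip_self_nonneg: "0 \<le> ip u u"
  by (simp add: ip_def sum_nonneg)

lemma ip_CS: "(ip u v)\<^sup>2 \<le> ip u u * ip v v"
  using Cauchy_Schwarz_ineq_sum[of u v C] by (simp add: ip_def power2_eq_square)

lemma ip_sum_right: "ip u (\<lambda>c. \<Sum>j\<in>J. a j * v j c) = (\<Sum>j\<in>J. a j * ip u (v j))"
proof -
  have "ip u (\<lambda>c. \<Sum>j\<in>J. a j * v j c) = (\<Sum>c\<in>C. \<Sum>j\<in>J. a j * (u c * v j c))"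
    by (simp add: ip_def sum_distrib_left mult_ac)
  also have "\<dots> = (\<Sum>j\<in>J. \<Sum>c\<in>C. a j * (u c * v j c))"
    by (rule sum.swap)
  finally show ?thesis by (simp add: ip_def sum_distrib_left)
qed

lemma T_linear: "T i (\<lambda>c. \<Sum>j\<in>J. a j * v j c) = (\<lambda>c. \<Sum>j\<in>J. a j * T i (v j) c)"
proof
  fix c
  have "T i (\<lambda>c. \<Sum>j\<in>J. a j * v j c) c = (\<Sum>d\<in>C. \<Sum>j\<in>J. a j * (M i c d * v j d))"
    by (simp add: T_def sum_distrib_left mult_ac)
  also have "\<dots> = (\<Sum>j\<in>J. \<Sum>d\<in>C. a j * (M i c d * v j d))"
    by (rule sum.swap)
  finally show "T i (\<lambda>c. \<Sum>j\<in>J. a j * v j c) c = (\<Sum>j\<in>J. a j * T i (v j) c)"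
    by (simp add: T_def sum_distrib_left)
qed

lemma G_linear: "G g (\<lambda>c. \<Sum>j\<in>J. a j * v j c) = (\<lambda>c. \<Sum>j\<in>J. a j * G g (v j) c)"
proof
  fix c
  have "G g (\<lambda>c. \<Sum>j\<in>J. a j * v j c) c = (\<Sum>i<n. \<Sum>j\<in>J. a j * (g i * T i (v j) c))"
    by (simp add: G_def T_linear sum_distrib_left mult_ac)
  also have "\<dots> = (\<Sum>j\<in>J. \<Sum>i<n. a j * (g i * T i (v j) c))"
    by (rule sum.swap)
  finally show "G g (\<lambda>c. \<Sum>j\<in>J. a j * v j c) c = (\<Sum>j\<in>J. a j * G g (v j) c)"
    by (simp add: G_def sum_distrib_left)
qed

lemma G_power_linear:
  "(G g ^^ q) (\<lambda>c. \<Sum>j\<in>J. a j * v j c) = (\<lambda>c. \<Sum>j\<in>J. a j * (G g ^^ q) (v j) c)"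
  by (induction q) (simp_all add: G_linear)

lemma T_symmetric: "i < n \<Longrightarrow> ip u (T i v) = ip (T i u) v"
proof -
  assume i: "i < n"
  have "ip u (T i v) = (\<Sum>c\<in>C. \<Sum>d\<in>C. u c * (M i c d * v d))"
    by (simp add: ip_def T_def sum_distrib_left)
  also have "\<dots> = (\<Sum>d\<in>C. \<Sum>c\<in>C. u c * (M i c d * v d))"
    by (rule sum.swap)
  also have "\<dots> = (\<Sum>d\<in>C. \<Sum>c\<in>C. M i d c * u c * v d)"
    by (intro sum.cong refl) (use M_sym[OF i] in \<open>simp add: mult_ac\<close>)
  finally show ?thesis
    by (simp add: ip_def T_def sum_distrib_right)
qed

lemma ip_commute: "ip u v = ip v u"
  by (simp add: ip_def mult.commute)

lemma G_symmetric: "ip u (G g v) = ip (G g u) v"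
proof -
  have "ip u (G g v) = (\<Sum>i<n. real_of_int (g i) * ip u (T i v))"
    unfolding G_def by (rule ip_sum_right)
  also have "\<dots> = (\<Sum>i<n. real_of_int (g i) * ip v (T i u))"
    by (intro sum.cong refl) (metis T_symmetric ip_commute lessThan_iff)
  also have "\<dots> = ip v (G g u)"
    unfolding G_def by (rule ip_sum_right[symmetric])
  finally show ?thesis by (simp add: ip_commute)
qed

lemma G_power_symmetric: "ip u ((G g ^^ q) v) = ip ((G g ^^ q) u) v"
proof (induction q arbitrary: v)
  case (Suc q)
  have "ip u ((G g ^^ Suc q) v) = ip u ((G g ^^ q) (G g v))" by (simp add: funpow_swap1)
  also have "\<dots> = ip ((G g ^^ Suc q) u) v" by (simp add: Suc.IH G_symmetric)
  finally show ?case .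
qed simp

lemma G_power_double: "ip u ((G g ^^ (2 * q)) u) = ip ((G g ^^ q) u) ((G g ^^ q) u)"
  by (simp add: mult_2 funpow_add G_power_symmetric)

text \<open>Jensen's inequality without a spectral decomposition: each Cauchy-Schwarz step doubles
  the exponent. This is why the moment order is taken to be a power of two.\<close>

lemma G_power_jensen:
  assumes "ip u u = 1" "0 \<le> ip u (G g u)"
  shows "ip u (G g u) ^ (2 ^ r) \<le> ip u ((G g ^^ (2 ^ r)) u)"
proof (induction r)
  case (Suc r)
  have "ip u (G g u) ^ (2 ^ Suc r) = (ip u (G g u) ^ (2 ^ r))\<^sup>2"
    by (simp add: mult.commute flip: power_mult)
  also have "\<dots> \<le> (ip u ((G g ^^ (2 ^ r)) u))\<^sup>2"
    by (intro power_mono Suc.IH zero_le_power assms)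
  also have "\<dots> \<le> ip u ((G g ^^ (2 ^ Suc r)) u)"
    using ip_CS[of u "(G g ^^ (2 ^ r)) u"] assms(1) by (simp add: G_power_double)
  finally show ?case .
qed simp

text \<open>The left side is the squared norm of the \<open>q\<close>-th power applied to
  \<open>u\<close>, the right side its squared Hilbert-Schmidt norm.\<close>

lemma G_power_le_trace:
  assumes "ip u u = 1"
  shows "ip u ((G g ^^ (2 * q)) u) \<le> (\<Sum>c\<in>C. ip (unit c) ((G g ^^ (2 * q)) (unit c)))"
proof -
  let ?w = "\<lambda>c. (G g ^^ q) (unit c)"
  \<comment> \<open>\<open>u\<close> may be nonzero off \<open>C\<close>; \<open>v\<close> agrees
    with it on \<open>C\<close> and is literally a combination of unit vectors, as linearity
    requires.\<close>
  define v where "v = (\<lambda>d. \<Sum>c\<in>C. u c * unit c d)"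
  have v: "v d = u d" if "d \<in> C" for d
    using that finite_C by (simp add: v_def unit_def if_distrib cong: if_cong)
  have "ip u ((G g ^^ (2 * q)) u) = ip ((G g ^^ q) v) ((G g ^^ q) v)"
  proof -
    have "ip x ((G g ^^ q) u) = ip x ((G g ^^ q) v)" for x
      unfolding G_power_symmetric by (simp add: ip_def v)
    then show ?thesis
      unfolding G_power_double by (metis ip_commute)
  qed
  also have "(G g ^^ q) v = (\<lambda>d. \<Sum>c\<in>C. u c * ?w c d)"
    unfolding v_def by (rule G_power_linear)
  also have "ip \<dots> \<dots> = (\<Sum>d\<in>C. (\<Sum>c\<in>C. u c * ?w c d)\<^sup>2)"
    by (simp add: ip_def power2_eq_square)
  also have "\<dots> \<le> (\<Sum>d\<in>C. (\<Sum>c\<in>C. (u c)\<^sup>2) * (\<Sum>c\<in>C. (?w c d)\<^sup>2))"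
    by (intro sum_mono Cauchy_Schwarz_ineq_sum)
  also have "(\<Sum>c\<in>C. (u c)\<^sup>2) = 1"
    using assms by (simp add: ip_def power2_eq_square)
  also have "(\<Sum>d\<in>C. 1 * (\<Sum>c\<in>C. (?w c d)\<^sup>2)) = (\<Sum>c\<in>C. \<Sum>d\<in>C. (?w c d)\<^sup>2)"
    by (simp only: mult_1_left) (rule sum.swap)
  also have "\<dots> = (\<Sum>c\<in>C. ip (unit c) ((G g ^^ (2 * q)) (unit c)))"
    unfolding G_power_double by (simp add: ip_def power2_eq_square)
  finally show ?thesis .
qed

text \<open>Peeling off the innermost \<open>G g\<close> gives a sum over \<open>j\<close>: the sign
  \<open>g j\<close> joins the monomial and \<open>T j v\<close> stays in the unit ball. The right
  side obeys the same recursion with every \<open>T j\<close> replaced by 1. Hence the induction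
  runs over all exponents \<open>e\<close> and all \<open>v\<close>.\<close>

lemma abs_average_word_le:
  assumes "ip u u \<le> 1" "ip v v \<le> 1"
  shows "\<bar>\<Sum>g\<in>sign_cube n. (\<Prod>i<n. real_of_int (g i) ^ e i) * ip u ((G g ^^ q) v)\<bar>
    \<le> (\<Sum>g\<in>sign_cube n. (\<Prod>i<n. real_of_int (g i) ^ e i) * real_of_int (\<Sum>i<n. g i) ^ q)"
  using assms(2)
proof (induction q arbitrary: e v)
  case 0
  have "\<bar>ip u v\<bar> \<le> 1"
  proof (rule power2_le_imp_le)
    have "(ip u v)\<^sup>2 \<le> ip u u * ip v v" by (rule ip_CS)
    also have "\<dots> \<le> 1" using assms(1) 0 by (intro mult_le_one ip_self_nonneg)
    finally show "\<bar>ip u v\<bar>\<^sup>2 \<le> 1\<^sup>2" by simp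
  qed simp
  then have "(\<Sum>g\<in>sign_cube n. \<Prod>i<n. real_of_int (g i) ^ e i) * \<bar>ip u v\<bar>
      \<le> (\<Sum>g\<in>sign_cube n. \<Prod>i<n. real_of_int (g i) ^ e i) * 1"
    by (intro mult_left_mono sum_sign_monomial_nonneg)
  moreover have "\<bar>\<Sum>g\<in>sign_cube n. \<Prod>i<n. real_of_int (g i) ^ e i\<bar> =
      (\<Sum>g\<in>sign_cube n. \<Prod>i<n. real_of_int (g i) ^ e i)"
    by (intro abs_of_nonneg sum_sign_monomial_nonneg)
  ultimately show ?case
    by (simp only: funpow_0 power_0 mult_1_right abs_mult sum_distrib_right[symmetric])
next
  case (Suc q)
  have bump: "(\<Prod>i<n. real_of_int (g i) ^ e i) * real_of_int (g j) =
      (\<Prod>i<n. real_of_int (g i) ^ (e(j := Suc (e j))) i)" if "j < n" for g :: "nat \<Rightarrow> int" and j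
  proof -
    have "j \<in> {..<n}" using that by simp
    note remove = prod.remove[OF finite_lessThan this]
    have "(\<Prod>i\<in>{..<n} - {j}. real_of_int (g i) ^ (e(j := Suc (e j))) i) =
        (\<Prod>i\<in>{..<n} - {j}. real_of_int (g i) ^ e i)"
      by (intro prod.cong) auto
    then show ?thesis
      unfolding remove[of "\<lambda>i. real_of_int (g i) ^ e i"]
        remove[of "\<lambda>i. real_of_int (g i) ^ (e(j := Suc (e j))) i"]
      by simp
  qed
  have expand: "(\<Sum>g\<in>sign_cube n. (\<Prod>i<n. real_of_int (g i) ^ e i) * ip u ((G g ^^ Suc q) v))
      = (\<Sum>j<n. \<Sum>g\<in>sign_cube n. (\<Prod>i<n. real_of_int (g i) ^ (e(j := Suc (e j))) i) * ip u ((G g ^^ q) (T j v)))"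
    (is "_ = ?R")
  proof -
    have "(\<Sum>g\<in>sign_cube n. (\<Prod>i<n. real_of_int (g i) ^ e i) * ip u ((G g ^^ Suc q) v))
      = (\<Sum>g\<in>sign_cube n. \<Sum>j<n. (\<Prod>i<n. real_of_int (g i) ^ e i) * real_of_int (g j) * ip u ((G g ^^ q) (T j v)))"
  proof (intro sum.cong refl)
    fix g
    have "ip u ((G g ^^ Suc q) v) = (\<Sum>j<n. real_of_int (g j) * ip u ((G g ^^ q) (T j v)))"
      by (simp only: funpow_Suc_right o_apply G_def[of g v] G_power_linear ip_sum_right)
    then show "(\<Prod>i<n. real_of_int (g i) ^ e i) * ip u ((G g ^^ Suc q) v) =
        (\<Sum>j<n. (\<Prod>i<n. real_of_int (g i) ^ e i) * real_of_int (g j) * ip u ((G g ^^ q) (T j v)))"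
      by (simp only: sum_distrib_left mult.assoc)
  qed
    also have "\<dots> = ?R"
      by (subst sum.swap) (intro sum.cong refl, simp only: bump lessThan_iff)
    finally show ?thesis .
  qed
  have "\<bar>?R\<bar> \<le> (\<Sum>j<n. \<bar>\<Sum>g\<in>sign_cube n. (\<Prod>i<n. real_of_int (g i) ^ (e(j := Suc (e j))) i) * ip u ((G g ^^ q) (T j v))\<bar>)"
    by (rule sum_abs)
  also have "\<dots> \<le> (\<Sum>j<n. \<Sum>g\<in>sign_cube n. (\<Prod>i<n. real_of_int (g i) ^ (e(j := Suc (e j))) i) * real_of_int (\<Sum>i<n. g i) ^ q)"
  proof (intro sum_mono Suc.IH)
    fix j assume "j \<in> {..<n}"
    then have "ip (T j v) (T j v) \<le> ip v v"
      using M_contraction[of j v] by (simp add: ip_def T_def power2_eq_square)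
    then show "ip (T j v) (T j v) \<le> 1" using Suc.prems by simp
  qed
  also have "\<dots> = (\<Sum>j<n. \<Sum>g\<in>sign_cube n. (\<Prod>i<n. real_of_int (g i) ^ e i) * real_of_int (g j) * real_of_int (\<Sum>i<n. g i) ^ q)"
    by (intro sum.cong refl) (simp only: bump lessThan_iff)
  also have "\<dots> = (\<Sum>g\<in>sign_cube n. \<Sum>j<n. (\<Prod>i<n. real_of_int (g i) ^ e i) * real_of_int (g j) * real_of_int (\<Sum>i<n. g i) ^ q)"
    by (rule sum.swap)
  also have "\<dots> = (\<Sum>g\<in>sign_cube n. (\<Prod>i<n. real_of_int (g i) ^ e i) * real_of_int (\<Sum>i<n. g i) ^ Suc q)"
    by (intro sum.cong refl)
      (simp only: of_int_sum power_Suc sum_distrib_left[symmetric] sum_distrib_right[symmetric] mult.assoc)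
  finally show ?case unfolding expand .
qed

theorem average_power_le:
  assumes "S \<subseteq> sign_cube n" and "0 \<le> a"
    and "\<And>g. g \<in> S \<Longrightarrow> ip (\<psi> g) (\<psi> g) = 1"
    and "\<And>g. g \<in> S \<Longrightarrow> a \<le> ip (\<psi> g) (G g (\<psi> g))"
    and "p = 2 ^ r"
  shows "real (card S) * a ^ (2 * p) \<le> real (card C) * (2 ^ n * (real p * real n) ^ p)"
proof -
  have "real (card S) * a ^ (2 * p) = (\<Sum>g\<in>S. a ^ (2 * p))" by simp
  also have "\<dots> \<le> (\<Sum>g\<in>S. \<Sum>c\<in>C. ip (unit c) ((G g ^^ (2 * p)) (unit c)))"
  proof (rule sum_mono)
    fix g assume g: "g \<in> S"
    have "a ^ (2 * p) \<le> ip (\<psi> g) (G g (\<psi> g)) ^ (2 ^ Suc r)"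
      using assms(2) assms(4)[OF g] by (simp add: assms(5) power_mono)
    also have "\<dots> \<le> ip (\<psi> g) ((G g ^^ (2 ^ Suc r)) (\<psi> g))"
      using assms(2-4) g by (intro G_power_jensen) force+
    also have "\<dots> \<le> (\<Sum>c\<in>C. ip (unit c) ((G g ^^ (2 * p)) (unit c)))"
      using G_power_le_trace[OF assms(3)[OF g], where g = g and q = p] by (simp add: assms(5))
    finally show "a ^ (2 * p) \<le> (\<Sum>c\<in>C. ip (unit c) ((G g ^^ (2 * p)) (unit c)))" .
  qed
  \<comment> \<open>Even powers have nonnegative trace, so the sign vectors outside \<open>S\<close>
    can only add.\<close>
  also have "\<dots> \<le> (\<Sum>g\<in>sign_cube n. \<Sum>c\<in>C. ip (unit c) ((G g ^^ (2 * p)) (unit c)))"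
    unfolding G_power_double
    by (intro sum_mono2 assms(1) sum_nonneg ip_self_nonneg) simp
  also have "\<dots> = (\<Sum>c\<in>C. \<Sum>g\<in>sign_cube n. ip (unit c) ((G g ^^ (2 * p)) (unit c)))"
    by (rule sum.swap)
  also have "\<dots> \<le> (\<Sum>c\<in>C. \<Sum>g\<in>sign_cube n. real_of_int (\<Sum>i<n. g i) ^ (2 * p))"
  proof (rule sum_mono)
    fix c assume "c \<in> C"
    then have "ip (unit c) (unit c) \<le> 1"
      using finite_C by (simp add: ip_def unit_def if_distrib cong: if_cong)
    from abs_average_word_le[OF this this, of "\<lambda>_. 0" "2 * p"]
    show "(\<Sum>g\<in>sign_cube n. ip (unit c) ((G g ^^ (2 * p)) (unit c)))
        \<le> (\<Sum>g\<in>sign_cube n. real_of_int (\<Sum>i<n. g i) ^ (2 * p))"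
      by simp
  qed
  also have "\<dots> = real (card C) * (\<Sum>g\<in>sign_cube n. real_of_int (\<Sum>i<n. g i) ^ (2 * p))"
    by simp
  also have "\<dots> \<le> real (card C) * (2 ^ n * (real p * real n) ^ p)"
    by (intro mult_left_mono rademacher_even_moment_le) simp
  finally show ?thesis .
qed

end

section \<open>Observables that are diagonal in a tight frame\<close>

lemma frame_multiplier_form:
  fixes \<phi> :: "'r \<Rightarrow> real" and u v :: "'c \<Rightarrow> real"
  assumes "finite C"
  shows "(\<Sum>c\<in>C. v c * (\<Sum>d\<in>C. (\<Sum>r\<in>J. \<phi> r * L r c * L r d) * u d)) =
    (\<Sum>r\<in>J. (\<phi> r * (\<Sum>c\<in>C. L r c * v c)) * (\<Sum>d\<in>C. L r d * u d))"
proof -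
  have "(\<Sum>c\<in>C. v c * (\<Sum>d\<in>C. (\<Sum>r\<in>J. \<phi> r * L r c * L r d) * u d)) =
      (\<Sum>c\<in>C. \<Sum>d\<in>C. \<Sum>r\<in>J. \<phi> r * (L r c * v c) * (L r d * u d))"
    by (simp add: sum_distrib_left sum_distrib_right mult_ac)
  also have "\<dots> = (\<Sum>c\<in>C. \<Sum>r\<in>J. \<Sum>d\<in>C. \<phi> r * (L r c * v c) * (L r d * u d))"
    by (intro sum.cong refl sum.swap)
  also have "\<dots> = (\<Sum>r\<in>J. \<Sum>c\<in>C. \<Sum>d\<in>C. \<phi> r * (L r c * v c) * (L r d * u d))"
    by (rule sum.swap)
  also have "\<dots> = (\<Sum>r\<in>J. (\<phi> r * (\<Sum>c\<in>C. L r c * v c)) * (\<Sum>d\<in>C. L r d * u d))"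
    by (simp only: sum_distrib_left[symmetric] sum_distrib_right[symmetric])
  finally show ?thesis .
qed

text \<open>The operator is the isometry given by \<open>L\<close>, then multiplication by
  \<open>\<phi>\<close>, then the adjoint of the isometry. With \<open>v\<close> the image of
  \<open>u\<close>, Cauchy-Schwarz on the inner product of \<open>v\<close> with itself gives
  \<open>?V\<^sup>2 \<le> ?V * ?U\<close>, and one factor \<open>?V\<close> cancels.\<close>

lemma frame_multiplier_contraction:
  fixes \<phi> :: "'r \<Rightarrow> real"
  assumes "finite C" "tight_frame C J L" and \<phi>: "\<And>r. \<bar>\<phi> r\<bar> \<le> 1"
  shows "(\<Sum>c\<in>C. (\<Sum>d\<in>C. (\<Sum>r\<in>J. \<phi> r * L r c * L r d) * u d)\<^sup>2) \<le> (\<Sum>c\<in>C. (u c)\<^sup>2)"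
proof -
  define v where "v = (\<lambda>c. \<Sum>d\<in>C. (\<Sum>r\<in>J. \<phi> r * L r c * L r d) * u d)"
  have parseval: "(\<Sum>r\<in>J. (\<Sum>c\<in>C. L r c * w c)\<^sup>2) = (\<Sum>c\<in>C. (w c)\<^sup>2)" for w
    using tight_frame_parseval[OF assms(1,2), of w w] by (simp add: power2_eq_square)
  let ?V = "\<Sum>c\<in>C. (v c)\<^sup>2" and ?U = "\<Sum>c\<in>C. (u c)\<^sup>2"
  have "?V = (\<Sum>r\<in>J. (\<phi> r * (\<Sum>c\<in>C. L r c * v c)) * (\<Sum>d\<in>C. L r d * u d))"
    using frame_multiplier_form[OF assms(1), of v \<phi> L J u] by (simp add: v_def power2_eq_square)
  then have "?V\<^sup>2 \<le> (\<Sum>r\<in>J. (\<phi> r * (\<Sum>c\<in>C. L r c * v c))\<^sup>2) * (\<Sum>r\<in>J. (\<Sum>d\<in>C. L r d * u d)\<^sup>2)"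
    by (simp only: Cauchy_Schwarz_ineq_sum)
  also have "\<dots> \<le> (\<Sum>r\<in>J. (\<Sum>c\<in>C. L r c * v c)\<^sup>2) * (\<Sum>r\<in>J. (\<Sum>d\<in>C. L r d * u d)\<^sup>2)"
  proof (intro mult_right_mono sum_mono sum_nonneg)
    fix r
    have "(\<phi> r)\<^sup>2 \<le> 1" using \<phi>[of r] by (simp add: abs_square_le_1)
    from mult_right_mono[OF this, of "(\<Sum>c\<in>C. L r c * v c)\<^sup>2"]
    show "(\<phi> r * (\<Sum>c\<in>C. L r c * v c))\<^sup>2 \<le> (\<Sum>c\<in>C. L r c * v c)\<^sup>2"
      by (simp add: power_mult_distrib)
  qed simp
  also have "\<dots> = ?V * ?U" unfolding parseval ..
  finally have "?V * ?V \<le> ?V * ?U" by (simp add: power2_eq_square)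
  moreover have "0 \<le> ?V" "0 \<le> ?U" by (simp_all add: sum_nonneg)
  ultimately have "?V \<le> ?U"
    using mult_strict_left_mono[of ?U ?V ?V] by linarith
  then show ?thesis by (simp add: v_def)
qed

subsection \<open>Symmetric powers\<close>

text \<open>A symmetric tensor of degree \<open>k\<close> over \<open>X\<close> is a function on words that depends on a word only
  through its type, the vector of letter counts. Normalised indicators of type classes form an
  orthonormal basis, so types serve as coordinates.\<close>

definition words :: "nat \<Rightarrow> 'a set \<Rightarrow> (nat \<Rightarrow> 'a) set" where
  "words k A = {..<k} \<rightarrow>\<^sub>E A"

definition word_type :: "nat \<Rightarrow> 'a set \<Rightarrow> (nat \<Rightarrow> 'a) \<Rightarrow> 'a \<Rightarrow> nat" where
  "word_type k X w = (\<lambda>a\<in>X. card {j\<in>{..<k}. w j = a})"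

definition types :: "nat \<Rightarrow> 'a set \<Rightarrow> ('a \<Rightarrow> nat) set" where
  "types k X = word_type k X ` words k X"

definition words_of_type :: "nat \<Rightarrow> 'a set \<Rightarrow> ('a \<Rightarrow> nat) \<Rightarrow> (nat \<Rightarrow> 'a) set" where
  "words_of_type k X c = {w \<in> words k X. word_type k X w = c}"

text \<open>Coordinates, in the basis of type classes, of the orthogonal projection of the product
  vector with factors \<open>h (r j)\<close> onto the symmetric tensors.\<close>

definition sym_frame :: "nat \<Rightarrow> 'a set \<Rightarrow> ('r \<Rightarrow> 'a \<Rightarrow> real) \<Rightarrow> (nat \<Rightarrow> 'r) \<Rightarrow> ('a \<Rightarrow> nat) \<Rightarrow> real" where
  "sym_frame k X h r c =
     (\<Sum>w\<in>words_of_type k X c. \<Prod>j<k. h (r j) (w j)) / sqrt (card (words_of_type k X c))"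

text \<open>The \<open>k\<close>-th tensor power of \<open>y\<close>: it is constant on each type
  class, and the square root comes from normalising the basis vector.\<close>

definition sym_power :: "nat \<Rightarrow> 'a set \<Rightarrow> ('a \<Rightarrow> real) \<Rightarrow> ('a \<Rightarrow> nat) \<Rightarrow> real" where
  "sym_power k X y c = sqrt (card (words_of_type k X c)) * (\<Prod>a\<in>X. y a ^ c a)"

lemma finite_words: "finite A \<Longrightarrow> finite (words k A)"
  by (simp add: words_def finite_PiE)

lemma finite_types: "finite X \<Longrightarrow> finite (types k X)"
  by (simp add: types_def finite_words)

lemma finite_words_of_type: "finite X \<Longrightarrow> finite (words_of_type k X c)"
  by (simp add: words_of_type_def finite_words)

lemma words_of_type_nonempty: "c \<in> types k X \<Longrightarrow> words_of_type k X c \<noteq> {}"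
  by (auto simp: types_def words_of_type_def)

lemma card_words_of_type_pos: "finite X \<Longrightarrow> c \<in> types k X \<Longrightarrow> 0 < card (words_of_type k X c)"
  by (simp add: card_gt_0_iff finite_words_of_type words_of_type_nonempty)

lemma types_subset: "types k X \<subseteq> X \<rightarrow>\<^sub>E {..k}"
proof -
  have "card {j\<in>{..<k}. w j = a} \<le> k" for w :: "nat \<Rightarrow> 'a" and a
    using card_mono[of "{..<k}" "{j\<in>{..<k}. w j = a}"] by auto
  then show ?thesis
    by (auto simp: types_def word_type_def)
qed

lemma sum_types_words_of_type:
  "finite X \<Longrightarrow> (\<Sum>c\<in>types k X. \<Sum>w\<in>words_of_type k X c. F w) = (\<Sum>w\<in>words k X. F w)"
  unfolding types_def words_of_type_def by (rule sum.image_gen[symmetric]) (rule finite_words)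

lemma prod_word_type:
  fixes y :: "'a \<Rightarrow> real"
  assumes "finite X" "w \<in> words k X"
  shows "(\<Prod>a\<in>X. y a ^ word_type k X w a) = (\<Prod>j<k. y (w j))"
proof -
  have "(\<Prod>j<k. y (w j)) = (\<Prod>a\<in>X. \<Prod>j\<in>{j\<in>{..<k}. w j = a}. y (w j))"
    using assms by (intro prod.group[symmetric]) (auto simp: words_def)
  also have "\<dots> = (\<Prod>a\<in>X. y a ^ word_type k X w a)"
    by (intro prod.cong refl) (simp add: word_type_def)
  finally show ?thesis ..
qed

lemma sum_types_power:
  fixes x :: real
  assumes "finite X" "c \<in> types k X"
  shows "(\<Prod>a\<in>X. x ^ c a) = x ^ k"
proof -
  obtain w where "w \<in> words k X" "c = word_type k X w"
    using assms(2) by (auto simp: types_def)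
  then show ?thesis using prod_word_type[OF assms(1), of w k "\<lambda>_. x"] by simp
qed

lemma prod_sum_words:
  fixes f :: "nat \<Rightarrow> 'a \<Rightarrow> real"
  assumes "finite A"
  shows "(\<Sum>w\<in>words k A. \<Prod>j<k. f j (w j)) = (\<Prod>j<k. \<Sum>a\<in>A. f j a)"
  unfolding words_def using assms by (subst prod_sum_PiE) auto

lemma frame_words_orthonormal:
  assumes "finite R" "tight_frame X R h" "w \<in> words k X" "w' \<in> words k X"
  shows "(\<Sum>r\<in>words k R. (\<Prod>j<k. h (r j) (w j)) * (\<Prod>j<k. h (r j) (w' j))) = (if w = w' then 1 else 0)"
proof -
  have "(\<Sum>r\<in>words k R. (\<Prod>j<k. h (r j) (w j)) * (\<Prod>j<k. h (r j) (w' j))) =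
      (\<Sum>r\<in>words k R. \<Prod>j<k. h (r j) (w j) * h (r j) (w' j))"
    by (simp add: prod.distrib)
  also have "\<dots> = (\<Prod>j<k. \<Sum>r\<in>R. h r (w j) * h r (w' j))"
    using assms(1) by (rule prod_sum_words)
  also have "\<dots> = (\<Prod>j<k. if w j = w' j then 1 else 0)"
  proof (intro prod.cong refl)
    fix j assume "j \<in> {..<k}"
    then have "w j \<in> X" "w' j \<in> X" using assms(3,4) by (auto simp: words_def)
    then show "(\<Sum>r\<in>R. h r (w j) * h r (w' j)) = (if w j = w' j then 1 else 0)"
      using assms(2) by (simp add: tight_frame_def)
  qed
  also have "\<dots> = (if w = w' then 1 else 0)"
  proof (cases "w = w'")
    case False
    then obtain j where "w j \<noteq> w' j" "j < k"
      using assms(3,4) unfolding words_def by (meson PiE_ext lessThan_iff)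
    then show ?thesis using False by (auto intro!: prod_zero)
  qed simp
  finally show ?thesis .
qed

text \<open>Product vectors resolve the identity of the full tensor power, and projecting them onto
  a subspace gives a resolution of the identity there.\<close>

lemma tight_frame_sym_frame:
  assumes "finite X" "finite R" "tight_frame X R h"
  shows "tight_frame (types k X) (words k R) (sym_frame k X h)"
  unfolding tight_frame_def
proof (intro ballI)
  fix c d assume cd: "c \<in> types k X" "d \<in> types k X"
  let ?H = "\<lambda>r w. \<Prod>j<k. h (r j) (w j)"
  let ?s = "\<lambda>c. sqrt (card (words_of_type k X c))"
  have "(\<Sum>r\<in>words k R. sym_frame k X h r c * sym_frame k X h r d) =
      (\<Sum>r\<in>words k R. \<Sum>w\<in>words_of_type k X c. \<Sum>w'\<in>words_of_type k X d. ?H r w * ?H r w' / (?s c * ?s d))"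
    by (simp add: sym_frame_def sum_product sum_divide_distrib)
  also have "\<dots> = (\<Sum>w\<in>words_of_type k X c. \<Sum>r\<in>words k R. \<Sum>w'\<in>words_of_type k X d. ?H r w * ?H r w' / (?s c * ?s d))"
    by (rule sum.swap)
  also have "\<dots> = (\<Sum>w\<in>words_of_type k X c. \<Sum>w'\<in>words_of_type k X d. \<Sum>r\<in>words k R. ?H r w * ?H r w' / (?s c * ?s d))"
    by (intro sum.cong refl sum.swap)
  also have "\<dots> = (\<Sum>w\<in>words_of_type k X c. \<Sum>w'\<in>words_of_type k X d. (if w = w' then 1 else 0) / (?s c * ?s d))"
    using frame_words_orthonormal[OF assms(2,3)]
    by (intro sum.cong refl) (auto simp: words_of_type_def simp flip: sum_divide_distrib)
  also have "\<dots> = (if c = d then 1 else 0)"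
  proof (cases "c = d")
    case True
    then show ?thesis
      using card_words_of_type_pos[OF assms(1) cd(1)] words_of_type_nonempty[OF cd(1)] finite_words_of_type[OF assms(1), of k c]
      by (simp add: if_distrib[of "\<lambda>x. x / _"] cong: if_cong)
  next
    case False
    then show ?thesis by (auto simp: words_of_type_def intro!: sum.neutral)
  qed
  finally show "(\<Sum>r\<in>words k R. sym_frame k X h r c * sym_frame k X h r d) = (if c = d then 1 else 0)" .
qed

text \<open>A tensor power of one vector is already symmetric, so projecting the frame vectors
  changes no inner product with it. The amplitudes factorise, and the \<open>k\<close> outcomes are
  independent.\<close>

lemma sym_frame_sym_power:
  assumes "finite X"
  shows "(\<Sum>c\<in>types k X. sym_frame k X h r c * sym_power k X y c) = (\<Prod>j<k. \<Sum>a\<in>X. h (r j) a * y a)"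
proof -
  have "(\<Sum>c\<in>types k X. sym_frame k X h r c * sym_power k X y c) =
      (\<Sum>c\<in>types k X. \<Sum>w\<in>words_of_type k X c. (\<Prod>j<k. h (r j) (w j) * y (w j)))"
  proof (intro sum.cong refl)
    fix c assume c: "c \<in> types k X"
    have "sym_frame k X h r c * sym_power k X y c =
        (\<Sum>w\<in>words_of_type k X c. \<Prod>j<k. h (r j) (w j)) * (\<Prod>a\<in>X. y a ^ c a)"
      using card_words_of_type_pos[OF assms c] by (simp add: sym_frame_def sym_power_def)
    also have "\<dots> = (\<Sum>w\<in>words_of_type k X c. (\<Prod>j<k. h (r j) (w j)) * (\<Prod>j<k. y (w j)))"
      unfolding sum_distrib_right
      by (intro sum.cong refl) (auto simp: words_of_type_def prod_word_type[OF assms])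
    finally show "sym_frame k X h r c * sym_power k X y c =
        (\<Sum>w\<in>words_of_type k X c. (\<Prod>j<k. h (r j) (w j) * y (w j)))"
      by (simp add: prod.distrib)
  qed
  also have "\<dots> = (\<Sum>w\<in>words k X. \<Prod>j<k. h (r j) (w j) * y (w j))"
    using assms by (rule sum_types_words_of_type)
  also have "\<dots> = (\<Prod>j<k. \<Sum>a\<in>X. h (r j) a * y a)"
    using assms by (rule prod_sum_words[where f = "\<lambda>j a. h (r j) a * y a"])
  finally show ?thesis .
qed

text \<open>Any tight frame of \<open>X\<close> will do: Parseval turns the squared norm into the
  total probability of \<open>k\<close> independent measurements.\<close>

lemma sym_power_unit:
  assumes "finite X" "finite R" "tight_frame X R h" "(\<Sum>a\<in>X. (y a)\<^sup>2) = 1"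
  shows "(\<Sum>c\<in>types k X. (sym_power k X y c)\<^sup>2) = 1"
proof -
  have y: "(\<Sum>r\<in>R. (\<Sum>a\<in>X. h r a * y a)\<^sup>2) = 1"
    using tight_frame_parseval[OF assms(1,3), of y y] assms(4) by (simp add: power2_eq_square)
  have "(\<Sum>c\<in>types k X. (sym_power k X y c)\<^sup>2) =
      (\<Sum>r\<in>words k R. (\<Sum>c\<in>types k X. sym_frame k X h r c * sym_power k X y c)\<^sup>2)"
    using tight_frame_parseval[OF finite_types tight_frame_sym_frame,
        OF assms(1) assms(1-3), of k "sym_power k X y" "sym_power k X y"]
    by (simp add: power2_eq_square)
  also have "\<dots> = (\<Sum>r\<in>words k R. \<Prod>j<k. (\<Sum>a\<in>X. h (r j) a * y a)\<^sup>2)"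
    by (simp add: sym_frame_sym_power assms(1) prod_power_distrib)
  also have "\<dots> = (\<Prod>j<k. \<Sum>r\<in>R. (\<Sum>a\<in>X. h r a * y a)\<^sup>2)"
    using assms(2) by (rule prod_sum_words[where f = "\<lambda>j r. (\<Sum>a\<in>X. h r a * y a)\<^sup>2"])
  also have "\<dots> = 1" by (simp add: y)
  finally show ?thesis .
qed

subsection \<open>Majority vote\<close>

lemma iid_variance:
  fixes q s :: "'r \<Rightarrow> real"
  assumes "finite R" and q1: "(\<Sum>r\<in>R. q r) = 1" and b: "(\<Sum>r\<in>R. q r * s r) = b"
  shows "(\<Sum>r\<in>words k R. (\<Prod>j<k. q (r j)) * ((\<Sum>j<k. s (r j)) - k * b)\<^sup>2) =
    k * (\<Sum>r\<in>R. q r * (s r - b)\<^sup>2)"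
proof -
  let ?V = "\<Sum>r\<in>R. q r * (s r - b)\<^sup>2"
  have centered: "(\<Sum>r\<in>R. q r * (s r - b)) = 0"
    using q1 b by (simp add: right_diff_distrib sum_subtractf flip: sum_distrib_right)
  have cov: "(\<Sum>r\<in>words k R. (\<Prod>j<k. q (r j)) * ((s (r i) - b) * (s (r l) - b))) =
      (if i = l then ?V else 0)" if il: "i < k" "l < k" for i l
  proof -
    \<comment> \<open>The centred factors are moved into positions \<open>i\<close> and
      \<open>l\<close> of the product; if \<open>i = l\<close>, both land in one factor and yield
      the variance.\<close>
    let ?f = "\<lambda>j r. q r * ((if j = i then s r - b else 1) * (if j = l then s r - b else 1))"
    have "(\<Sum>r\<in>words k R. (\<Prod>j<k. q (r j)) * ((s (r i) - b) * (s (r l) - b))) =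
        (\<Sum>r\<in>words k R. \<Prod>j<k. ?f j (r j))"
      using il by (simp add: prod.distrib prod.delta)
    also have "\<dots> = (\<Prod>j<k. \<Sum>r\<in>R. ?f j r)"
      using assms(1) by (rule prod_sum_words)
    also have "\<dots> = (if i = l then ?V else 0)"
    proof (cases "i = l")
      case True
      have "(\<Prod>j<k. \<Sum>r\<in>R. ?f j r) = (\<Prod>j<k. if j = i then ?V else 1)"
        by (intro prod.cong refl) (auto simp: True q1 power2_eq_square)
      then show ?thesis using il True by (simp add: prod.delta)
    next
      case False
      have "(\<Sum>r\<in>R. ?f i r) = 0" using False centered by simp
      then have "(\<Prod>j<k. \<Sum>r\<in>R. ?f j r) = 0"
        using il by (intro prod_zero bexI[of _ i]) auto
      then show ?thesis using False by simp
    qed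
    finally show ?thesis .
  qed
  have "(\<Sum>r\<in>words k R. (\<Prod>j<k. q (r j)) * ((\<Sum>j<k. s (r j)) - k * b)\<^sup>2) =
      (\<Sum>r\<in>words k R. \<Sum>i<k. \<Sum>l<k. (\<Prod>j<k. q (r j)) * ((s (r i) - b) * (s (r l) - b)))"
  proof (intro sum.cong refl)
    fix r
    have "(\<Sum>j<k. s (r j)) - k * b = (\<Sum>j<k. s (r j) - b)"
      by (simp add: sum_subtractf)
    then have "((\<Sum>j<k. s (r j)) - k * b)\<^sup>2 = (\<Sum>i<k. \<Sum>l<k. (s (r i) - b) * (s (r l) - b))"
      by (simp only: power2_eq_square sum_product)
    then show "(\<Prod>j<k. q (r j)) * ((\<Sum>j<k. s (r j)) - k * b)\<^sup>2 =
        (\<Sum>i<k. \<Sum>l<k. (\<Prod>j<k. q (r j)) * ((s (r i) - b) * (s (r l) - b)))"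
      by (simp only: sum_distrib_left)
  qed
  also have "\<dots> = (\<Sum>i<k. \<Sum>r\<in>words k R. \<Sum>l<k. (\<Prod>j<k. q (r j)) * ((s (r i) - b) * (s (r l) - b)))"
    by (rule sum.swap)
  also have "\<dots> = (\<Sum>i<k. \<Sum>l<k. \<Sum>r\<in>words k R. (\<Prod>j<k. q (r j)) * ((s (r i) - b) * (s (r l) - b)))"
    by (intro sum.cong refl sum.swap)
  also have "\<dots> = (\<Sum>i<k. \<Sum>l<k. if i = l then ?V else 0)"
    by (intro sum.cong refl) (simp only: cov lessThan_iff)
  also have "\<dots> = k * ?V" by simp
  finally show ?thesis .
qed

text \<open>A pointwise Chebyshev inequality: for \<open>x \<le> 0\<close> the left side is at most
  -1. Taking expectations then needs no tail event, and ties are covered.\<close>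

lemma sgn_ge_chebyshev:
  fixes x \<mu> :: real
  assumes "0 < \<mu>"
  shows "1 - 2 * (x - \<mu>)\<^sup>2 / \<mu>\<^sup>2 \<le> sgn x"
proof (cases "x > 0")
  case False
  have "\<mu>\<^sup>2 \<le> (x - \<mu>)\<^sup>2"
    using power_mono[of \<mu> "\<mu> - x" 2] False assms by (simp add: power2_commute)
  then have "2 \<le> 2 * (x - \<mu>)\<^sup>2 / \<mu>\<^sup>2"
    using assms by (simp add: field_simps)
  then show ?thesis by (smt (verit) sgn_real_def)
qed simp

text \<open>The votes sum to \<open>k * b\<close> on average with variance at most \<open>k\<close>,
  so averaging the pointwise inequality leaves 1 - 2 / (k b^2), at least 1/2 by
  \<open>kb\<close>.\<close>

lemma majority_vote_bias:
  fixes q s :: "'r \<Rightarrow> real"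
  assumes "finite R" "\<And>r. r \<in> R \<Longrightarrow> 0 \<le> q r" and q1: "(\<Sum>r\<in>R. q r) = 1"
    and s: "\<And>r. r \<in> R \<Longrightarrow> (s r)\<^sup>2 = 1"
    and b: "(\<Sum>r\<in>R. q r * s r) = b" "0 < b" and kb: "4 \<le> k * b\<^sup>2"
  shows "1 / 2 \<le> (\<Sum>r\<in>words k R. (\<Prod>j<k. q (r j)) * sgn (\<Sum>j<k. s (r j)))"
proof -
  have k: "0 < real k" using kb by (cases k) auto
  define \<mu> where "\<mu> = k * b"
  have \<mu>: "0 < \<mu>" using k b(2) by (simp add: \<mu>_def)
  let ?Q = "\<lambda>r. \<Prod>j<k. q (r j)"
  have Q1: "(\<Sum>r\<in>words k R. ?Q r) = 1"
    using prod_sum_words[OF assms(1), of "\<lambda>_. q" k] by (simp add: q1)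
  have "(\<Sum>r\<in>R. q r * (s r - b)\<^sup>2) = (\<Sum>r\<in>R. q r * (1 + b\<^sup>2) - 2 * b * (q r * s r))"
    by (intro sum.cong refl) (simp add: power2_diff s algebra_simps)
  also have "\<dots> = 1 - b\<^sup>2"
    by (simp add: sum_subtractf q1 b(1) power2_eq_square flip: sum_distrib_left sum_distrib_right)
  finally have V: "(\<Sum>r\<in>R. q r * (s r - b)\<^sup>2) \<le> 1" by simp
  have half: "2 / \<mu>\<^sup>2 * k \<le> 1 / 2"
  proof -
    have "2 / \<mu>\<^sup>2 * k = 2 / (k * b\<^sup>2)" using k by (simp add: \<mu>_def power2_eq_square)
    also have "\<dots> \<le> 2 / 4" using kb by (intro divide_left_mono) auto
    finally show ?thesis by simp
  qed
  have "2 / \<mu>\<^sup>2 * (k * (\<Sum>r\<in>R. q r * (s r - b)\<^sup>2)) \<le> 2 / \<mu>\<^sup>2 * (real k * 1)"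
    by (rule mult_left_mono[OF mult_left_mono[OF V]]) auto
  then have "1 / 2 \<le> 1 - 2 / \<mu>\<^sup>2 * (k * (\<Sum>r\<in>R. q r * (s r - b)\<^sup>2))"
    using half by simp
  also have "\<dots> = (\<Sum>r\<in>words k R. ?Q r) - 2 / \<mu>\<^sup>2 * (\<Sum>r\<in>words k R. ?Q r * ((\<Sum>j<k. s (r j)) - \<mu>)\<^sup>2)"
    unfolding Q1 \<mu>_def iid_variance[OF assms(1) q1 b(1)] ..
  also have "\<dots> = (\<Sum>r\<in>words k R. ?Q r * (1 - 2 * ((\<Sum>j<k. s (r j)) - \<mu>)\<^sup>2 / \<mu>\<^sup>2))"
    by (simp add: right_diff_distrib sum_subtractf sum_distrib_left mult_ac)
  also have "\<dots> \<le> (\<Sum>r\<in>words k R. ?Q r * sgn (\<Sum>j<k. s (r j)))"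
    using assms(2) by (intro sum_mono mult_left_mono sgn_ge_chebyshev \<mu> prod_nonneg) (auto simp: words_def)
  finally show ?thesis .
qed

subsection \<open>Lower bound on the dimension of the symmetric power\<close>

text \<open>\<open>\<beta>\<close> is the expected majority vote on \<open>k\<close> copies of
  \<open>y\<close>. The bound -1 is for indices that fail to decode. For the others the bias
  \<open>2 * \<eta>\<close> and \<open>1 \<le> k * \<eta>\<^sup>2\<close> supply the 4 that the
  majority vote asks for.\<close>

lemma frame_majority_form:
  fixes s :: "'r \<Rightarrow> real"
  assumes X: "finite X" and R: "finite R" and h: "tight_frame X R h"
    and y: "(\<Sum>a\<in>X. (y a)\<^sup>2) = 1" and s: "\<And>r. r \<in> R \<Longrightarrow> (s r)\<^sup>2 = 1"
    and \<sigma>: "\<sigma> \<in> {-1, 1}" and k: "1 \<le> k * \<eta>\<^sup>2"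
  defines "\<beta> \<equiv> \<Sum>r\<in>words k R. sgn (\<Sum>j<k. s (r j)) * (\<Sum>c\<in>types k X. sym_frame k X h r c * sym_power k X y c)\<^sup>2"
  shows "-1 \<le> \<sigma> * \<beta>"
    and "0 < \<eta> \<Longrightarrow> 2 * \<eta> \<le> \<sigma> * (\<Sum>r\<in>R. s r * (\<Sum>a\<in>X. h r a * y a)\<^sup>2) \<Longrightarrow> 1 / 2 \<le> \<sigma> * \<beta>"
proof -
  define q where "q r = (\<Sum>a\<in>X. h r a * y a)\<^sup>2" for r
  have q: "0 \<le> q r" for r by (simp add: q_def)
  have q1: "(\<Sum>r\<in>R. q r) = 1"
    using tight_frame_parseval[OF X h, of y y] y by (simp add: q_def power2_eq_square)
  have Q1: "(\<Sum>r\<in>words k R. \<Prod>j<k. q (r j)) = 1"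
    using prod_sum_words[OF R, of "\<lambda>_. q" k] by (simp add: q1)
  have \<sigma>\<beta>: "\<sigma> * \<beta> = (\<Sum>r\<in>words k R. (\<Prod>j<k. q (r j)) * sgn (\<Sum>j<k. \<sigma> * s (r j)))"
    using \<sigma> unfolding \<beta>_def sym_frame_sym_power[OF X] q_def prod_power_distrib
    by (auto simp: sum_distrib_left sgn_minus sum_negf mult_ac)
  have "(\<Sum>r\<in>words k R. (\<Prod>j<k. q (r j)) * (-1)) \<le> \<sigma> * \<beta>"
    unfolding \<sigma>\<beta> by (intro sum_mono mult_left_mono prod_nonneg) (auto simp: q sgn_real_def)
  then show "-1 \<le> \<sigma> * \<beta>" by (simp add: Q1 sum_negf)
  show "1 / 2 \<le> \<sigma> * \<beta>" if "0 < \<eta>" "2 * \<eta> \<le> \<sigma> * (\<Sum>r\<in>R. s r * (\<Sum>a\<in>X. h r a * y a)\<^sup>2)"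
  proof -
    define b where "b = (\<Sum>r\<in>R. q r * (\<sigma> * s r))"
    have b: "2 * \<eta> \<le> b"
      using that(2) by (simp add: b_def q_def sum_distrib_left mult_ac)
    have "4 \<le> k * (2 * \<eta>)\<^sup>2" using k by (simp add: power_mult_distrib)
    also have "\<dots> \<le> k * b\<^sup>2" using b that(1) by (intro mult_left_mono power_mono) auto
    finally have kb: "4 \<le> k * b\<^sup>2" .
    show ?thesis
      unfolding \<sigma>\<beta>
      by (rule majority_vote_bias[OF R _ q1, where b = b]) (use \<sigma> s b kb that(1) q in \<open>auto simp: b_def power_mult_distrib\<close>)
  qed
qed

theorem card_types_lower_bound:
  fixes n k :: nat and \<eta> :: real and S :: "(nat \<Rightarrow> int) set" and y :: "(nat \<Rightarrow> int) \<Rightarrow> 'a \<Rightarrow> real"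
    and R :: "nat \<Rightarrow> 'r set" and h :: "nat \<Rightarrow> 'r \<Rightarrow> 'a \<Rightarrow> real" and s :: "nat \<Rightarrow> 'r \<Rightarrow> real"
  assumes X: "finite X" and n: "10 \<le> n" and \<eta>: "0 < \<eta>" "1 \<le> k * \<eta>\<^sup>2"
    and S: "S \<subseteq> sign_cube n" "2 powr (99 / 100 * n) \<le> card S"
    and R: "\<And>i. i < n \<Longrightarrow> finite (R i)" and h: "\<And>i. i < n \<Longrightarrow> tight_frame X (R i) (h i)"
    and s: "\<And>i r. i < n \<Longrightarrow> r \<in> R i \<Longrightarrow> (s i r)\<^sup>2 = 1"
    and y: "\<And>g. g \<in> S \<Longrightarrow> (\<Sum>a\<in>X. (y g a)\<^sup>2) = 1"
    and decode: "\<And>g. g \<in> S \<Longrightarrow> 99 / 100 * n \<le>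
      card {i. i < n \<and> 2 * \<eta> \<le> g i * (\<Sum>r\<in>R i. s i r * (\<Sum>a\<in>X. h i r a * y g a)\<^sup>2)}"
  shows "2 powr (n / 25) \<le> card (types k X)"
proof -
  \<comment> \<open>A tie counts as 0; only \<open>\<bar>\<phi> i r\<bar> \<le> 1\<close> matters
    for the contraction property.\<close>
  define \<phi> where "\<phi> = (\<lambda>i r. sgn (\<Sum>j<k. s i (r j)))"
  define L where "L = (\<lambda>i. sym_frame k X (h i))"
  define M where "M = (\<lambda>i c d. \<Sum>r\<in>words k (R i). \<phi> i r * L i r c * L i r d)"
  define \<psi> where "\<psi> = (\<lambda>g. sym_power k X (y g))"
  interpret symmetric_contractions "types k X" n M
  proof
    show "finite (types k X)" using X by (rule finite_types)
    show "M i c d = M i d c" for i c d by (simp add: M_def mult_ac)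
    show "(\<Sum>c\<in>types k X. (\<Sum>d\<in>types k X. M i c d * u d)\<^sup>2) \<le> (\<Sum>c\<in>types k X. (u c)\<^sup>2)" if "i < n" for i u
      unfolding M_def L_def
      by (intro frame_multiplier_contraction finite_types tight_frame_sym_frame X R h that)
        (simp add: \<phi>_def sgn_real_def)
  qed
  \<comment> \<open>The frame of decoder 0 serves as the auxiliary one; it exists because
    \<open>10 \<le> n\<close>.\<close>
  have unit_\<psi>: "ip (\<psi> g) (\<psi> g) = 1" if "g \<in> S" for g
    using sym_power_unit[OF X R h y[OF that], of 0] n by (simp add: ip_def \<psi>_def power2_eq_square)
  have bias: "9 / 20 * n \<le> ip (\<psi> g) (G g (\<psi> g))" if g: "g \<in> S" for g
  proof -
    define good where "good = {i. i < n \<and> 2 * \<eta> \<le> g i * (\<Sum>r\<in>R i. s i r * (\<Sum>a\<in>X. h i r a * y g a)\<^sup>2)}"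
    have good: "good \<subseteq> {..<n}" by (auto simp: good_def)
    have form: "ip (\<psi> g) (T i (\<psi> g)) = (\<Sum>r\<in>words k (R i). sgn (\<Sum>j<k. s i (r j)) *
        (\<Sum>c\<in>types k X. sym_frame k X (h i) r c * sym_power k X (y g) c)\<^sup>2)" for i
      using frame_multiplier_form[OF finite_C, of "\<psi> g" "\<phi> i" "L i" "words k (R i)" "\<psi> g"]
      unfolding ip_def T_def by (simp add: M_def L_def \<phi>_def \<psi>_def power2_eq_square mult.assoc)
    have each: "(if i \<in> good then 1 / 2 else -1) \<le> g i * ip (\<psi> g) (T i (\<psi> g))" if i: "i < n" for i
    proof -
      have "g i \<in> {-1, 1}"
        using S(1) g i unfolding sign_cube_def by (blast dest: PiE_mem)
      then have "real_of_int (g i) \<in> {-1, 1}" by auto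
      note facts = frame_majority_form[where s = "s i", OF X R[OF i] h[OF i] y[OF g] s[OF i] this \<eta>(2),
          folded form]
      show ?thesis using facts \<eta>(1) i by (auto simp: good_def)
    qed
    have "99 / 100 * n \<le> card good" using decode[OF g] by (simp add: good_def)
    \<comment> \<open>Decoded indices contribute at least 1/2 and the others at least -1, so the
      total is at least (3/2 * 99/100 - 1) n = 0.485 n, rounded down to 9/20.\<close>
    then have "9 / 20 * n \<le> 3 / 2 * card good - n" by simp
    also have "\<dots> = (\<Sum>i<n. (if i \<in> good then 3 / 2 else 0) - 1)"
      using good by (simp add: sum_subtractf sum.If_cases Int_absorb1)
    also have "\<dots> = (\<Sum>i<n. if i \<in> good then 1 / 2 else -1)"
      by (intro sum.cong) auto
    also have "\<dots> \<le> (\<Sum>i<n. g i * ip (\<psi> g) (T i (\<psi> g)))"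
      using each by (intro sum_mono) simp
    also have "\<dots> = ip (\<psi> g) (G g (\<psi> g))"
      unfolding G_def by (rule ip_sum_right[symmetric])
    finally show ?thesis .
  qed
  have "1 \<le> n div 10" using n by linarith
  then obtain r where r: "2 ^ r \<le> n div 10" "n div 10 < 2 ^ (r + 1)"
    using ex_power_ivl1[of 2 "n div 10"] by auto
  \<comment> \<open>\<open>p\<close> at most n/10 gives 2 p n <= (9 n / 20)^2, a gain of 2 in each
    of the \<open>p\<close> factors. \<open>p\<close> above n/20 makes the total gain at least
    2^(n/20); after the loss 2^(n/100) from the size of \<open>S\<close>, 2^(n/25) remains.\<close>
  define p :: nat where "p = 2 ^ r"
  have p: "10 * p \<le> n" "n < 20 * p" using r by (auto simp: p_def)
  let ?D = "card (types k X)"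
  have "card S * (9 / 20 * n) ^ (2 * p) \<le> ?D * (2 ^ n * (real p * real n) ^ p)"
    by (rule average_power_le[where \<psi> = \<psi> and r = r]) (use S unit_\<psi> bias in \<open>auto simp: p_def\<close>)
  moreover have "(2 * (real p * real n)) ^ p \<le> (9 / 20 * n) ^ (2 * p)"
  proof -
    have "2 * (real p * real n) \<le> 2 * (n / 10 * n)"
      using p by (intro mult_left_mono mult_right_mono) auto
    also have "\<dots> \<le> (9 / 20 * n)\<^sup>2" by (simp add: power2_eq_square)
    finally show ?thesis unfolding power_mult by (intro power_mono) auto
  qed
  ultimately have "card S * (2 * (real p * real n)) ^ p \<le> ?D * (2 ^ n * (real p * real n) ^ p)"
    by (meson mult_left_mono of_nat_0_le_iff order_trans)
  then have "(card S * 2 ^ p) * (real p * real n) ^ p \<le> (?D * 2 ^ n) * (real p * real n) ^ p"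
    by (simp add: power_mult_distrib mult_ac)
  then have D: "card S * 2 ^ p \<le> ?D * (2::real) ^ n"
    using p n by (subst (asm) mult_le_cancel_right_pos) auto
  have "2 powr (n / 25) * 2 powr n = 2 powr (99 / 100 * n) * 2 powr (n / 20)"
    by (simp flip: powr_add)
  also have "\<dots> \<le> card S * 2 powr p"
    using p by (intro mult_mono S(2) powr_mono) auto
  also have "\<dots> \<le> ?D * 2 powr n" using D by (simp add: powr_realpow)
  finally show ?thesis by simp
qed

section \<open>Upper bounds for the number of types\<close>

lemma card_types_le_power:
  assumes "finite X"
  shows "card (types k X) \<le> (k + 1) ^ card X"
  using card_mono[OF _ types_subset, of X k] assms by (simp add: card_PiE finite_PiE)

text \<open>The letter counts of a type sum to \<open>k\<close>, so each type weighs
  \<open>x ^ k\<close>; all count vectors together weigh at most the \<open>card X\<close>-th power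
  of a geometric series.\<close>

lemma card_types_generating_bound:
  fixes x :: real
  assumes X: "finite X" and x: "0 < x" "x < 1"
  shows "card (types k X) * x ^ k * (1 - x) ^ card X \<le> 1"
proof -
  have geo: "(\<Sum>j\<le>k. x ^ j) * (1 - x) \<le> 1"
  proof -
    have "(\<Sum>j\<le>k. x ^ j) * (1 - x) = 1 - x ^ Suc k"
      using sum_gp0[of x k] x by (simp add: field_simps)
    then show ?thesis using x by simp
  qed
  have "card (types k X) * x ^ k = (\<Sum>c\<in>types k X. \<Prod>a\<in>X. x ^ c a)"
    by (simp add: sum_types_power[OF X])
  also have "\<dots> \<le> (\<Sum>c\<in>X \<rightarrow>\<^sub>E {..k}. \<Prod>a\<in>X. x ^ c a)"
    using X x by (intro sum_mono2 types_subset finite_PiE prod_nonneg) auto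
  also have "\<dots> = (\<Prod>a\<in>X. \<Sum>j\<le>k. x ^ j)"
    using X by (subst prod_sum_PiE) auto
  also have "\<dots> = (\<Sum>j\<le>k. x ^ j) ^ card X" by simp
  finally have "card (types k X) * x ^ k * (1 - x) ^ card X \<le> (\<Sum>j\<le>k. x ^ j) ^ card X * (1 - x) ^ card X"
    using x by (intro mult_right_mono) auto
  also have "\<dots> = ((\<Sum>j\<le>k. x ^ j) * (1 - x)) ^ card X" by (simp add: power_mult_distrib)
  also have "\<dots> \<le> 1" using geo x by (intro power_le_one mult_nonneg_nonneg sum_nonneg) auto
  finally show ?thesis .
qed

lemma ln_card_types_le:
  assumes X: "finite X" "X \<noteq> {}" and k: "0 < k"
  shows "ln (card (types k X)) \<le> k * (1 + ln (1 + card X / k))"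
proof -
  define N where "N = card X"
  have N: "0 < N" using X by (simp add: N_def card_gt_0_iff)
  have "types k X \<noteq> {}" using X(2) by (auto simp: types_def words_def PiE_eq_empty_iff)
  then have D: "0 < card (types k X)" using X(1) by (simp add: card_gt_0_iff finite_types)
  \<comment> \<open>The maximiser of x^k (1 - x)^N, hence the best choice in the generating function
    bound.\<close>
  define x :: real where "x = k / (N + k)"
  have x: "0 < x" "x < 1" using N k by (auto simp: x_def)
  have "ln (card (types k X) * x ^ k * (1 - x) ^ N) \<le> ln 1"
    using card_types_generating_bound[OF X(1) x, of k] D x
    by (subst ln_le_cancel_iff) (auto simp: N_def)
  then have "ln (card (types k X)) \<le> k * (- ln x) + N * (- ln (1 - x))"
    using D x by (simp add: ln_mult ln_realpow)
  moreover have "- ln x = ln (1 + N / k)"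
  proof -
    have "inverse x = 1 + N / k" using k by (simp add: x_def field_simps)
    then show ?thesis using x by (metis ln_inverse)
  qed
  moreover have "N * (- ln (1 - x)) \<le> k"
  proof -
    have "inverse (1 - x) = 1 + k / N" using N by (simp add: x_def field_simps)
    then have "- ln (1 - x) = ln (1 + k / N)" using x by (metis ln_inverse diff_gt_0_iff_gt)
    also have "\<dots> \<le> k / N" by (intro ln_add_one_self_le_self) auto
    finally have "N * (- ln (1 - x)) \<le> N * (k / N)" by (intro mult_left_mono) auto
    then show ?thesis using N by simp
  qed
  ultimately show ?thesis by (simp add: N_def algebra_simps)
qed

subsection \<open>Bounds for codes given by frames\<close>

text \<open>\<open>u\<close> stands for 1 / eta^2 and \<open>k\<close> for its ceiling. Replacing
  \<open>k + 1\<close> by \<open>u\<^sup>2\<close> merely doubles the logarithm, which costs an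
  additive constant after the second logarithm.\<close>

lemma log_dimension_bound:
  fixes n m k :: nat and u :: real
  assumes u: "4 \<le> u" "real k + 1 \<le> u\<^sup>2" and n: "1 \<le> n"
    and D: "10 \<le> n \<Longrightarrow> 2 powr (n / 25) \<le> real D" "D \<le> (k + 1) ^ (2 ^ m)"
  shows "log 2 n - log 2 (log 2 u) - 6 \<le> m"
proof -
  have "log 2 4 \<le> log 2 u" using u(1) by (subst log_le_cancel_iff) auto
  moreover have "log 2 (4::real) = 2"
    using log_pow_cancel[of "2::real" 2] by simp
  ultimately have lu: "2 \<le> log 2 u" by simp
  then have llu: "0 \<le> log 2 (log 2 u)" by (subst zero_le_log_cancel_iff) auto
  show ?thesis
  proof (cases "10 \<le> n")
    case False
    have "log 2 n \<le> log 2 (2 ^ 6)" using False n by (subst log_le_cancel_iff) auto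
    also have "\<dots> = 6" by (subst log_pow_cancel) auto
    finally have "log 2 n \<le> 6" .
    then show ?thesis using llu by linarith
  next
    case True
    have "2 powr (n / 25) \<le> real ((k + 1) ^ (2 ^ m))"
      using D(1)[OF True] D(2) by linarith
    also have "\<dots> = (real k + 1) ^ (2 ^ m)" by (simp add: add.commute)
    also have "\<dots> \<le> (u\<^sup>2) ^ (2 ^ m)" by (intro power_mono u(2)) simp
    finally have "log 2 (2 powr (n / 25)) \<le> log 2 ((u\<^sup>2) ^ (2 ^ m))"
      using u(1) by (subst log_le_cancel_iff) auto
    then have "n / 25 \<le> 2 ^ m * (2 * log 2 u)"
      using u(1) by (simp add: log_nat_power)
    then have "n \<le> 2 ^ m * (50 * log 2 u)" by simp
    \<comment> \<open>50 is 25 times the 2 from squaring \<open>u\<close>; rounding it up to 64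
      yields the constant 6, which also covers \<open>n < 10\<close>.\<close>
    also have "\<dots> \<le> 2 ^ m * (2 ^ 6 * log 2 u)" using lu by (intro mult_left_mono mult_right_mono) auto
    finally have "log 2 n \<le> log 2 (2 ^ m * (2 ^ 6 * log 2 u))"
      using n lu by (subst log_le_cancel_iff) auto
    also have "\<dots> = m + (6 + log 2 (log 2 u))"
      using lu log_pow_cancel[of "2::real" 6]
      by (subst log_mult, simp, simp, subst log_mult) (auto simp: log_nat_power)
    finally show ?thesis by linarith
  qed
qed

text \<open>Were the bound false, 2^m / k would be at most 2^(K / 1000) with
  \<open>K = n / u\<close>, so ln D / k would grow like 0.0007 K, whereas the lower bound on
  \<open>D\<close> makes it at least 0.02 K.\<close>

lemma ln_dimension_bound:
  fixes n m k :: nat and u :: real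
  assumes u: "4 \<le> u" "u \<le> k" "k \<le> u + 1" and n: "100 * u \<le> n"
    and D: "2 powr (n / 25) \<le> real D" "ln D \<le> k * (1 + ln (1 + 2 ^ m / k))"
  shows "log 2 u + 1 / 1000 * (n / u) \<le> m"
proof (rule ccontr)
  assume *: "\<not> log 2 u + 1 / 1000 * (n / u) \<le> m"
  define K where "K = n / u"
  have K: "100 \<le> K" using n u(1) by (simp add: K_def field_simps)
  have k: "0 < real k" using u by linarith
  have ln2: "0.625 \<le> ln (2::real)" "ln (2::real) \<le> 0.7"
    using ln2_ge_two_thirds ln2_le_25_over_36 by simp_all
  have "2 ^ m = 2 powr m" by (simp add: powr_realpow)
  also have "\<dots> < 2 powr (log 2 u + 1 / 1000 * K)"
    using * by (intro powr_less_mono) (auto simp: K_def)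
  also have "\<dots> = u * 2 powr (K / 1000)"
    using u(1) by (simp add: powr_add)
  also have "\<dots> \<le> k * 2 powr (K / 1000)"
    using u(2) by (intro mult_right_mono) auto
  finally have "2 ^ m / k \<le> 2 powr (K / 1000)"
    using k by (simp add: field_simps)
  moreover have "1 \<le> 2 powr (K / 1000)" using K by (intro ge_one_powr_ge_zero) auto
  ultimately have "1 + 2 ^ m / k \<le> 2 * 2 powr (K / 1000)" by linarith
  then have "ln (1 + 2 ^ m / k) \<le> ln (2 * 2 powr (K / 1000))"
    using k by (subst ln_le_cancel_iff) (auto intro: add_pos_nonneg)
  also have "\<dots> = ln 2 * (1 + K / 1000)"
    by (simp add: ln_mult ln_powr algebra_simps)
  also have "\<dots> \<le> 0.7 * (1 + K / 1000)"
    using ln2 K by (intro mult_right_mono) auto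
  finally have upper: "1 + ln (1 + 2 ^ m / k) \<le> 1.7 + 0.7 * K / 1000" by simp
  \<comment> \<open>\<open>k \<le> u + 1 \<le> 1.25 * u\<close> because \<open>4 \<le> u\<close>,
    and 1.25 * 0.02 = 0.625 / 25.\<close>
  have "k * (0.02 * K) \<le> (1.25 * u) * (0.02 * K)"
    using u K by (intro mult_right_mono) auto
  also have "\<dots> = n / 25 * 0.625" using u(1) by (simp add: K_def)
  also have "\<dots> \<le> n / 25 * ln 2" using ln2 by (intro mult_left_mono) auto
  also have "\<dots> = ln (2 powr (n / 25))" by (simp add: ln_powr)
  also have "\<dots> \<le> ln D"
  proof -
    have "(0::real) < 2 powr (n / 25)" by simp
    then show ?thesis using D(1) by (subst ln_le_cancel_iff) linarith+
  qed
  also have "\<dots> \<le> k * (1.7 + 0.7 * K / 1000)"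
    using D(2) mult_left_mono[OF upper, of "real k"] k by linarith
  finally have "0.02 * K \<le> 1.7 + 0.7 * K / 1000"
    using k by simp
  \<comment> \<open>Already at \<open>K = 100\<close> the sides are 2 and 1.77; this is where the
    threshold 10 / sqrt n for \<open>\<eta>\<close> enters.\<close>
  then show False using K by simp
qed

theorem frame_code_bounds:
  fixes n m :: nat and \<eta> :: real and S :: "(nat \<Rightarrow> int) set" and y :: "(nat \<Rightarrow> int) \<Rightarrow> 'a \<Rightarrow> real"
    and R :: "nat \<Rightarrow> 'r set" and h :: "nat \<Rightarrow> 'r \<Rightarrow> 'a \<Rightarrow> real" and s :: "nat \<Rightarrow> 'r \<Rightarrow> real"
  assumes X: "finite X" "card X = 2 ^ m" and n: "1 \<le> n" and \<eta>: "0 < \<eta>" "\<eta> \<le> 1 / 2"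
    and S: "large_message_set n t S" "t \<le> 1 / 100 * n"
    and R: "\<And>i. i < n \<Longrightarrow> finite (R i)" and h: "\<And>i. i < n \<Longrightarrow> tight_frame X (R i) (h i)"
    and s: "\<And>i r. i < n \<Longrightarrow> r \<in> R i \<Longrightarrow> (s i r)\<^sup>2 = 1"
    and y: "\<And>g. g \<in> S \<Longrightarrow> (\<Sum>a\<in>X. (y g a)\<^sup>2) = 1"
    and decode: "\<And>g. g \<in> S \<Longrightarrow> 99 / 100 * n \<le>
      card {i. i < n \<and> 2 * \<eta> \<le> g i * (\<Sum>r\<in>R i. s i r * (\<Sum>a\<in>X. h i r a * y g a)\<^sup>2)}"
  shows "log 2 n - log 2 (log 2 (1 / \<eta>\<^sup>2)) - 6 \<le> m"
    and "10 / sqrt n \<le> \<eta> \<Longrightarrow> log 2 (1 / \<eta>\<^sup>2) + 1 / 1000 * (\<eta>\<^sup>2 * n) \<le> m"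
proof -
  define u where "u = 1 / \<eta>\<^sup>2"
  define k where "k = nat \<lceil>u\<rceil>"
  have "\<eta>\<^sup>2 \<le> (1 / 2)\<^sup>2" using \<eta> by (intro power_mono) auto
  then have u: "4 \<le> u" using \<eta> by (simp add: u_def field_simps power2_eq_square)
  then have k: "u \<le> k" "k \<le> u + 1" unfolding k_def by linarith+
  have k\<eta>: "1 \<le> k * \<eta>\<^sup>2" using k(1) \<eta> by (simp add: u_def field_simps)
  have "k \<noteq> 0" using k u by auto
  have "4 * u \<le> u\<^sup>2" using u by (simp add: power2_eq_square)
  then have ku: "real k + 1 \<le> u\<^sup>2" using k u by linarith
  have S': "S \<subseteq> sign_cube n" "2 powr (99 / 100 * n) \<le> card S"
  proof -
    show sub: "S \<subseteq> sign_cube n" using S(1) by (simp add: large_message_set_def)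
    have "0 < card S"
      using S(1) finite_subset[OF sub] by (auto simp: large_message_set_def card_gt_0_iff)
    moreover have "99 / 100 * n \<le> log 2 (card S)"
      using S unfolding large_message_set_def by linarith
    ultimately show "2 powr (99 / 100 * n) \<le> card S"
      by (subst (asm) le_log_iff) auto
  qed
  have lower: "2 powr (n / 25) \<le> card (types k X)" if "10 \<le> n"
    using X(1) that \<eta>(1) k\<eta> S' R h s y decode by (rule card_types_lower_bound)
  show "log 2 n - log 2 (log 2 (1 / \<eta>\<^sup>2)) - 6 \<le> m"
    using log_dimension_bound[OF u ku n lower] card_types_le_power[OF X(1), of k]
    by (simp add: X(2) u_def)
  show "log 2 (1 / \<eta>\<^sup>2) + 1 / 1000 * (\<eta>\<^sup>2 * n) \<le> m" if "10 / sqrt n \<le> \<eta>"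
  proof -
    have "(10 / sqrt n)\<^sup>2 \<le> \<eta>\<^sup>2" using that by (intro power_mono) auto
    then have nu: "100 * u \<le> n" using n \<eta> by (simp add: u_def power_divide field_simps)
    then have "10 \<le> n" using u by linarith
    moreover have "X \<noteq> {}" using X(2) by auto
    ultimately have "log 2 u + 1 / 1000 * (n / u) \<le> m"
      using ln_card_types_le[OF X(1), of k] \<open>k \<noteq> 0\<close>
      by (intro ln_dimension_bound[OF u k nu lower]) (simp_all add: X(2))
    then show ?thesis by (simp add: u_def mult.commute)
  qed
qed

lemma two_outcome_bias:
  fixes p :: "int \<Rightarrow> real"
  assumes "p 1 + p (-1) = 1" "\<sigma> \<in> {-1, 1}" "1 - (1 / 2 - \<eta>) \<le> p \<sigma>"
  shows "2 * \<eta> \<le> \<sigma> * (p 1 - p (-1))"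
  using assms by auto

lemma large_message_set_sign:
  "large_message_set n t S \<Longrightarrow> g \<in> S \<Longrightarrow> i < n \<Longrightarrow> g i \<in> {-1, 1}"
  unfolding large_message_set_def sign_cube_def by (blast dest: PiE_mem)

text \<open>Here \<open>p g i s\<close> is the probability that the \<open>i\<close>-th decoder outputs \<open>s\<close>. A classical code fits
  this form with the square roots of the codeword probabilities as \<open>y g\<close>, a quantum code with a
  factorisation of the effects as \<open>h i\<close>.\<close>

lemma weak_code_bounds:
  fixes n m :: nat and \<eta> \<delta> :: real and y :: "(nat \<Rightarrow> int) \<Rightarrow> 'a \<Rightarrow> real"
    and h :: "nat \<Rightarrow> 'a \<times> int \<Rightarrow> 'a \<Rightarrow> real" and p :: "(nat \<Rightarrow> int) \<Rightarrow> nat \<Rightarrow> int \<Rightarrow> real"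
  assumes X: "finite X" "card X = 2 ^ m" and n: "1 \<le> n" and \<eta>: "0 < \<eta>" "\<eta> \<le> 1 / 2"
    and S: "large_message_set n t S" "t \<le> 1 / 100 * n"
    and h: "\<And>i. i < n \<Longrightarrow> tight_frame X (X \<times> {-1, 1}) (h i)"
    and y: "\<And>g. g \<in> S \<Longrightarrow> (\<Sum>a\<in>X. (y g a)\<^sup>2) = 1"
    and p: "\<And>g i s. g \<in> S \<Longrightarrow> i < n \<Longrightarrow> s \<in> {-1, 1} \<Longrightarrow>
      p g i s = (\<Sum>r\<in>X. (\<Sum>a\<in>X. h i (r, s) a * y g a)\<^sup>2)"
    and decode: "\<And>g. g \<in> S \<Longrightarrow> (1 - \<delta>) * n \<le> card {i. i < n \<and> 1 - (1 / 2 - \<eta>) \<le> p g i (g i)}"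
    and \<delta>: "\<delta> \<le> 1 / 100"
  shows "log 2 n - log 2 (log 2 (1 / \<eta>\<^sup>2)) - 6 \<le> m"
    and "10 / sqrt n \<le> \<eta> \<Longrightarrow> log 2 (1 / \<eta>\<^sup>2) + 1 / 1000 * (\<eta>\<^sup>2 * n) \<le> m"
proof -
  let ?R = "\<lambda>i::nat. X \<times> {-1, 1 :: int}"
  let ?bias = "\<lambda>g i. \<Sum>r\<in>?R i. real_of_int (snd r) * (\<Sum>a\<in>X. h i r a * y g a)\<^sup>2"
  have decode': "99 / 100 * n \<le> card {i. i < n \<and> 2 * \<eta> \<le> g i * ?bias g i}" if g: "g \<in> S" for g
  proof -
    have "2 * \<eta> \<le> g i * ?bias g i" if i: "i < n" and dec: "1 - (1 / 2 - \<eta>) \<le> p g i (g i)" for i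
    proof -
      have split: "(\<Sum>r\<in>?R i. F r) = (\<Sum>r\<in>X. F (r, 1)) + (\<Sum>r\<in>X. F (r, -1))" for F :: "'a \<times> int \<Rightarrow> real"
        using X(1) by (simp add: sum.cartesian_product' sum.distrib)
      have "p g i 1 + p g i (-1) = (\<Sum>r\<in>?R i. (\<Sum>a\<in>X. h i r a * y g a)\<^sup>2)"
        unfolding split using p[OF g i] by simp
      also have "\<dots> = 1"
        using tight_frame_parseval[OF X(1) h[OF i], of "y g" "y g"] y[OF g] by (simp add: power2_eq_square)
      finally have "2 * \<eta> \<le> g i * (p g i 1 - p g i (-1))"
        using large_message_set_sign[OF S(1) g i] dec by (rule two_outcome_bias)
      also have "p g i 1 - p g i (-1) = ?bias g i"
        unfolding split using p[OF g i] by (simp add: sum_negf)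
      finally show ?thesis .
    qed
    then have "card {i. i < n \<and> 1 - (1 / 2 - \<eta>) \<le> p g i (g i)} \<le> card {i. i < n \<and> 2 * \<eta> \<le> g i * ?bias g i}"
      by (intro card_mono) auto
    moreover have "99 / 100 * n \<le> (1 - \<delta>) * n" using \<delta> by (intro mult_right_mono) auto
    ultimately show ?thesis using decode[OF g] by linarith
  qed
  have fin: "finite (?R i)" for i using X(1) by simp
  have s: "(real_of_int (snd r))\<^sup>2 = 1" if "r \<in> ?R i" for i r using that by auto
  note bounds = frame_code_bounds[where R = ?R and s = "\<lambda>i r. real_of_int (snd r)" and h = h and y = y,
      OF X n \<eta> S fin h s y decode']
  show "log 2 n - log 2 (log 2 (1 / \<eta>\<^sup>2)) - 6 \<le> m"
    by (rule bounds(1))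
  show "10 / sqrt n \<le> \<eta> \<Longrightarrow> log 2 (1 / \<eta>\<^sup>2) + 1 / 1000 * (\<eta>\<^sup>2 * n) \<le> m"
    by (rule bounds(2))
qed

subsection \<open>Classical codes\<close>

lemma classical_prob_sum:
  assumes "set_pmf \<mu> \<subseteq> sign_cube m"
  shows "classical_prob \<mu> Di s = (\<Sum>w\<in>sign_cube m. pmf (Di w) s * pmf \<mu> w)"
  unfolding classical_prob_def pmf_bind
  using assms by (intro integral_measure_pmf_real) auto

lemma pmf_two_outcomes:
  assumes "set_pmf q \<subseteq> {-1, 1 :: int}"
  shows "pmf q (-1) + pmf q 1 = 1"
  using sum_pmf_eq_1[OF _ assms] by simp

lemma weak_classical_bounds:
  fixes \<eta> \<delta> t :: real
  assumes code: "weak_classical_rac m n (1 / 2 - \<eta>) \<delta> t S y D"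
    and n: "1 \<le> n" and \<eta>: "0 < \<eta>" "\<eta> \<le> 1 / 2" and \<delta>: "\<delta> \<le> 1 / 100" and t: "t \<le> 1 / 100 * n"
  shows "log 2 n - log 2 (log 2 (1 / \<eta>\<^sup>2)) - 6 \<le> m"
    and "10 / sqrt n \<le> \<eta> \<Longrightarrow> log 2 (1 / \<eta>\<^sup>2) + 1 / 1000 * (\<eta>\<^sup>2 * n) \<le> m"
proof -
  \<comment> \<open>Outcome \<open>(w, s)\<close> means reading the codeword \<open>w\<close> in the
    standard basis and then letting the randomized decoder output \<open>s\<close>.\<close>
  define h where "h = (\<lambda>i (r :: (nat \<Rightarrow> int) \<times> int) a. if a = fst r then sqrt (pmf (D i (fst r)) (snd r)) else 0)"
  define amp where "amp = (\<lambda>g a. sqrt (pmf (y g) a))"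
  have S: "large_message_set n t S" and enc: "\<And>g. g \<in> S \<Longrightarrow> set_pmf (y g) \<subseteq> sign_cube m"
    and dec: "\<And>i w. i < n \<Longrightarrow> w \<in> sign_cube m \<Longrightarrow> set_pmf (D i w) \<subseteq> {-1, 1}"
    and good: "\<And>g. g \<in> S \<Longrightarrow>
      (1 - \<delta>) * n \<le> card {i. i < n \<and> 1 - (1 / 2 - \<eta>) \<le> classical_prob (y g) (D i) (g i)}"
    using code by (auto simp: weak_classical_rac_def classical_encoder_def classical_decoders_def)
  have frame: "tight_frame (sign_cube m) (sign_cube m \<times> {-1, 1}) (h i)" if "i < n" for i
    unfolding tight_frame_def
  proof (intro ballI)
    fix a b assume ab: "a \<in> sign_cube m" "b \<in> sign_cube m"
    have "(\<Sum>r\<in>sign_cube m \<times> {-1, 1}. h i r a * h i r b) =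
        (\<Sum>w\<in>sign_cube m. if w = a then if a = b then pmf (D i a) (-1) + pmf (D i a) 1 else 0 else 0)"
      unfolding sum.cartesian_product' by (intro sum.cong refl) (auto simp: h_def)
    also have "\<dots> = (if a = b then 1 else 0)"
      using ab pmf_two_outcomes[OF dec[OF that ab(1)]] by auto
    finally show "(\<Sum>r\<in>sign_cube m \<times> {-1, 1}. h i r a * h i r b) = (if a = b then 1 else 0)" .
  qed
  have unit: "(\<Sum>a\<in>sign_cube m. (amp g a)\<^sup>2) = 1" if "g \<in> S" for g
    using sum_pmf_eq_1[OF _ enc[OF that]] by (simp add: amp_def)
  have prob: "classical_prob (y g) (D i) s = (\<Sum>r\<in>sign_cube m. (\<Sum>a\<in>sign_cube m. h i (r, s) a * amp g a)\<^sup>2)"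
    if "g \<in> S" for g i s
    unfolding classical_prob_sum[OF enc[OF that]]
    by (intro sum.cong refl)
      (simp add: h_def amp_def if_distrib[of "\<lambda>x. x * _"] power_mult_distrib cong: if_cong)
  note bounds = weak_code_bounds[where h = h and y = amp and p = "\<lambda>g i. classical_prob (y g) (D i)",
      OF finite_sign_cube card_sign_cube n \<eta> S t frame unit prob good \<delta>]
  show "log 2 n - log 2 (log 2 (1 / \<eta>\<^sup>2)) - 6 \<le> m"
    by (rule bounds(1))
  show "10 / sqrt n \<le> \<eta> \<Longrightarrow> log 2 (1 / \<eta>\<^sup>2) + 1 / 1000 * (\<eta>\<^sup>2 * n) \<le> m"
    by (rule bounds(2))
qed

subsection \<open>Pure quantum codes\<close>

text \<open>Lets a complex effect be replaced by its real part, which is again symmetric and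
  positive semidefinite; the real parts of the two effects still sum to the identity.\<close>

lemma Re_quadratic_form_real:
  fixes f :: "real Matrix.vec"
  assumes "A \<in> carrier_mat d d" "f \<in> carrier_vec d"
  shows "Re (cscalar_prod (A *\<^sub>v map_vec complex_of_real f) (map_vec complex_of_real f)) =
    (\<Sum>a<d. \<Sum>b<d. f $ a * Re (A $$ (a, b)) * f $ b)"
  using assms
  by (simp add: scalar_prod_def mult_mat_vec_def sum_distrib_left sum_distrib_right mult_ac
      flip: atLeast0LessThan)

lemma psd_mat_Re_sym:
  assumes "psd_mat d A" "a < d" "b < d"
  shows "Re (A $$ (a, b)) = Re (A $$ (b, a))"
proof -
  have A: "A \<in> carrier_mat d d" "mat_adjoint A = A" using assms(1) by (auto simp: psd_mat_def)
  have "mat_adjoint A $$ (a, b) = cnj (A $$ (b, a))"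
    using A(1) assms(2,3) by (simp add: mat_adjoint_def mat_of_rows_index)
  then show ?thesis by (simp add: A(2))
qed

lemma psd_mat_gram:
  assumes "psd_mat d A"
  shows "\<exists>B. \<forall>a\<in>{..<d}. \<forall>b\<in>{..<d}. Re (A $$ (a, b)) = (\<Sum>r<d. B r a * B r b)"
proof (rule psd_kernel_gram)
  show "Re (A $$ (a, b)) = Re (A $$ (b, a))" if "a \<in> {..<d}" "b \<in> {..<d}" for a b
    using psd_mat_Re_sym[OF assms] that by simp
  show "0 \<le> (\<Sum>a<d. \<Sum>b<d. v a * Re (A $$ (a, b)) * v b)" for v
  proof -
    have A: "A \<in> carrier_mat d d" using assms by (simp add: psd_mat_def)
    have "map_vec complex_of_real (Matrix.vec d v) \<in> carrier_vec d" by simp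
    then have "0 \<le> Re (cscalar_prod (A *\<^sub>v map_vec complex_of_real (Matrix.vec d v)) (map_vec complex_of_real (Matrix.vec d v)))"
      using assms unfolding psd_mat_def by blast
    then show ?thesis
      by (simp add: Re_quadratic_form_real[OF A])
  qed
qed simp

lemma weak_pure_quantum_bounds:
  fixes \<eta> \<delta> t :: real
  assumes code: "weak_pure_quantum_rac m n (1 / 2 - \<eta>) \<delta> t S y E"
    and n: "1 \<le> n" and \<eta>: "0 < \<eta>" "\<eta> \<le> 1 / 2" and \<delta>: "\<delta> \<le> 1 / 100" and t: "t \<le> 1 / 100 * n"
  shows "log 2 n - log 2 (log 2 (1 / \<eta>\<^sup>2)) - 6 \<le> m"
    and "10 / sqrt n \<le> \<eta> \<Longrightarrow> log 2 (1 / \<eta>\<^sup>2) + 1 / 1000 * (\<eta>\<^sup>2 * n) \<le> m"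
proof -
  define d :: nat where "d = 2 ^ m"
  have S: "large_message_set n t S"
    and enc: "\<And>g. g \<in> S \<Longrightarrow> y g \<in> carrier_vec d" "\<And>g. g \<in> S \<Longrightarrow> scalar_prod (y g) (y g) = 1"
    and povm: "\<And>i. i < n \<Longrightarrow> two_outcome_povm d (E i)"
    and good: "\<And>g. g \<in> S \<Longrightarrow>
      (1 - \<delta>) * n \<le> card {i. i < n \<and> 1 - (1 / 2 - \<eta>) \<le> quantum_prob (y g) (E i) (g i)}"
    using code by (auto simp: weak_pure_quantum_rac_def quantum_encoder_def quantum_decoders_def d_def)
  have psd: "psd_mat d (E i s)" if "i < n" "s \<in> {-1, 1}" for i s
    using povm[OF that(1)] that(2) by (auto simp: two_outcome_povm_def)
  then have "\<forall>i s. \<exists>B. i < n \<and> s \<in> {-1, 1} \<longrightarrow>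
      (\<forall>a\<in>{..<d}. \<forall>b\<in>{..<d}. Re (E i s $$ (a, b)) = (\<Sum>r<d. B r a * B r b))"
    using psd_mat_gram by blast
  then obtain B where B: "\<And>i s a b. i < n \<Longrightarrow> s \<in> {-1, 1} \<Longrightarrow> a < d \<Longrightarrow> b < d \<Longrightarrow>
      Re (E i s $$ (a, b)) = (\<Sum>r<d. B i s r a * B i s r b)"
    by (metis lessThan_iff)
  define h where "h = (\<lambda>i (r :: nat \<times> int) a. B i (snd r) (fst r) a)"
  have frame: "tight_frame {..<d} ({..<d} \<times> {-1, 1}) (h i)" if i: "i < n" for i
    unfolding tight_frame_def
  proof (intro ballI)
    fix a b assume ab: "a \<in> {..<d}" "b \<in> {..<d}"
    have carrier: "E i 1 \<in> carrier_mat d d" "E i (-1) \<in> carrier_mat d d"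
      using psd[OF i] by (auto simp: psd_mat_def)
    have "(\<Sum>r\<in>{..<d} \<times> {-1, 1}. h i r a * h i r b) = Re (E i (-1) $$ (a, b)) + Re (E i 1 $$ (a, b))"
      using B[OF i, of _ a b] ab by (simp add: sum.cartesian_product' sum.distrib h_def)
    also have "\<dots> = Re ((E i 1 + E i (-1)) $$ (a, b))"
      using carrier ab by simp
    also have "E i 1 + E i (-1) = 1\<^sub>m d"
      using povm[OF i] by (simp add: two_outcome_povm_def)
    finally show "(\<Sum>r\<in>{..<d} \<times> {-1, 1}. h i r a * h i r b) = (if a = b then 1 else 0)"
      using ab by simp
  qed
  have unit: "(\<Sum>a<d. (y g $ a)\<^sup>2) = 1" if "g \<in> S" for g
    using enc[OF that] by (simp add: scalar_prod_def power2_eq_square atLeast0LessThan)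
  have prob: "quantum_prob (y g) (E i) s = (\<Sum>r<d. (\<Sum>a<d. h i (r, s) a * y g $ a)\<^sup>2)"
    if g: "g \<in> S" and i: "i < n" and s: "s \<in> {-1, 1}" for g i s
  proof -
    have "E i s \<in> carrier_mat d d" using psd[OF i s] by (simp add: psd_mat_def)
    then have "quantum_prob (y g) (E i) s = (\<Sum>a<d. \<Sum>b<d. y g $ a * Re (E i s $$ (a, b)) * y g $ b)"
      unfolding quantum_prob_def Let_def by (rule Re_quadratic_form_real) (rule enc(1)[OF g])
    also have "\<dots> = (\<Sum>a<d. \<Sum>b<d. \<Sum>r<d. (h i (r, s) a * y g $ a) * (h i (r, s) b * y g $ b))"
      by (intro sum.cong refl) (simp add: B[OF i s] h_def sum_distrib_left sum_distrib_right mult_ac)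
    also have "\<dots> = (\<Sum>a<d. \<Sum>r<d. \<Sum>b<d. (h i (r, s) a * y g $ a) * (h i (r, s) b * y g $ b))"
      by (intro sum.cong refl sum.swap)
    also have "\<dots> = (\<Sum>r<d. \<Sum>a<d. \<Sum>b<d. (h i (r, s) a * y g $ a) * (h i (r, s) b * y g $ b))"
      by (rule sum.swap)
    also have "\<dots> = (\<Sum>r<d. (\<Sum>a<d. h i (r, s) a * y g $ a)\<^sup>2)"
      by (simp only: power2_eq_square sum_product)
    finally show ?thesis .
  qed
  have card: "card {..<d} = 2 ^ m" by (simp add: d_def)
  note bounds = weak_code_bounds[where h = h and y = "\<lambda>g a. y g $ a" and p = "\<lambda>g i. quantum_prob (y g) (E i)",
      OF finite_lessThan card n \<eta> S t frame unit prob good \<delta>]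
  show "log 2 n - log 2 (log 2 (1 / \<eta>\<^sup>2)) - 6 \<le> m"
    by (rule bounds(1))
  show "10 / sqrt n \<le> \<eta> \<Longrightarrow> log 2 (1 / \<eta>\<^sup>2) + 1 / 1000 * (\<eta>\<^sup>2 * n) \<le> m"
    by (rule bounds(2))
qed

section \<open>Full codes as weak codes, and the universal constants\<close>

lemma large_message_set_sign_cube: "large_message_set n 0 (sign_cube n)"
  using card_gt_0_iff[of "sign_cube n"]
  by (simp add: large_message_set_def card_sign_cube log_nat_power)

lemma classical_rac_weak:
  "classical_rac m n \<epsilon> y D \<Longrightarrow> weak_classical_rac m n \<epsilon> 0 0 (sign_cube n) y D"
  by (auto simp: classical_rac_def weak_classical_rac_def large_message_set_sign_cube
      cong: conj_cong Collect_cong)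

lemma pure_quantum_rac_weak:
  "pure_quantum_rac m n \<epsilon> y E \<Longrightarrow> weak_pure_quantum_rac m n \<epsilon> 0 0 (sign_cube n) y E"
  by (auto simp: pure_quantum_rac_def weak_pure_quantum_rac_def large_message_set_sign_cube
      cong: conj_cong Collect_cong)

theorem mainTheorem7:
  shows "\<exists>C c \<delta>\<^sub>0 t\<^sub>0 :: real. c > 0 \<and> \<delta>\<^sub>0 > 0 \<and> t\<^sub>0 > 0 \<and>
    (\<forall>(m::nat) (n::nat) (\<eta>::real).
       n \<ge> 1 \<and> 0 < \<eta> \<and> \<eta> \<le> 1/2 \<and>
       ((\<exists>y D. classical_rac m n (1/2 - \<eta>) y D) \<or>
        (\<exists>y E. pure_quantum_rac m n (1/2 - \<eta>) y E))
       \<longrightarrow> real m \<ge> log 2 (real n) - log 2 (log 2 (1 / \<eta>\<^sup>2)) - C \<and>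
           (\<eta> \<ge> 10 / sqrt (real n) \<longrightarrow> real m \<ge> log 2 (1 / \<eta>\<^sup>2) + c * (\<eta>\<^sup>2 * real n))) \<and>
    (\<forall>(m::nat) (n::nat) (\<eta>::real) (\<delta>::real) (t::real) (S::(nat \<Rightarrow> int) set).
       n \<ge> 1 \<and> 0 < \<eta> \<and> \<eta> \<le> 1/2 \<and> \<delta> \<le> \<delta>\<^sub>0 \<and> t \<le> t\<^sub>0 * real n \<and>
       ((\<exists>y D. weak_classical_rac m n (1/2 - \<eta>) \<delta> t S y D) \<or>
        (\<exists>y E. weak_pure_quantum_rac m n (1/2 - \<eta>) \<delta> t S y E))
       \<longrightarrow> real m \<ge> log 2 (real n) - log 2 (log 2 (1 / \<eta>\<^sup>2)) - C \<and>
           (\<eta> \<ge> 10 / sqrt (real n) \<longrightarrow> real m \<ge> log 2 (1 / \<eta>\<^sup>2) + c * (\<eta>\<^sup>2 * real n)))"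
proof -
  have weak: "real m \<ge> log 2 (real n) - log 2 (log 2 (1 / \<eta>\<^sup>2)) - 6 \<and>
      (\<eta> \<ge> 10 / sqrt (real n) \<longrightarrow> real m \<ge> log 2 (1 / \<eta>\<^sup>2) + 1 / 1000 * (\<eta>\<^sup>2 * real n))"
    if "n \<ge> 1" "0 < \<eta>" "\<eta> \<le> 1/2" "\<delta> \<le> 1 / 100" "t \<le> 1 / 100 * real n"
      "(\<exists>y D. weak_classical_rac m n (1/2 - \<eta>) \<delta> t S y D) \<or>
        (\<exists>y E. weak_pure_quantum_rac m n (1/2 - \<eta>) \<delta> t S y E)"
    for m n :: nat and \<eta> \<delta> t :: real and S
    using weak_classical_bounds[of m n \<eta> \<delta> t S, OF _ that(1-5)]
      weak_pure_quantum_bounds[of m n \<eta> \<delta> t S, OF _ that(1-5)] that(6)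
    by blast
  have full: "real m \<ge> log 2 (real n) - log 2 (log 2 (1 / \<eta>\<^sup>2)) - 6 \<and>
      (\<eta> \<ge> 10 / sqrt (real n) \<longrightarrow> real m \<ge> log 2 (1 / \<eta>\<^sup>2) + 1 / 1000 * (\<eta>\<^sup>2 * real n))"
    if "n \<ge> 1" "0 < \<eta>" "\<eta> \<le> 1/2"
      "(\<exists>y D. classical_rac m n (1/2 - \<eta>) y D) \<or> (\<exists>y E. pure_quantum_rac m n (1/2 - \<eta>) y E)"
    for m n :: nat and \<eta> :: real
  proof (rule weak[where \<delta> = 0 and t = 0 and S = "sign_cube n"])
    show "(\<exists>y D. weak_classical_rac m n (1/2 - \<eta>) 0 0 (sign_cube n) y D) \<or>
        (\<exists>y E. weak_pure_quantum_rac m n (1/2 - \<eta>) 0 0 (sign_cube n) y E)"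
      using that(4) classical_rac_weak pure_quantum_rac_weak by blast
  qed (use that in auto)
  show ?thesis
    \<comment> \<open>6 and 1/1000 are the constants of the two dimension bounds; both values 1/100
      are what the bias 9/20 and the exponent n/25 were computed with.\<close>
    by (rule exI[of _ 6], rule exI[of _ "1 / 1000"], rule exI[of _ "1 / 100"], rule exI[of _ "1 / 100"],
      intro conjI) (simp, simp, simp, use full in blast, use weak in blast)
qed

end
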